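(* Let $m\ge 1$, $q\in(0,1)$, $c_2\in(0,1)$, $l_{00}\in[0,1)$. Let $P_1=(P_{11},\dots,P_{1m})$ and $P_2=(P_{21},\dots,P_{2m})$ be the random vectors of primary and follow-up study $p$-values for $m$ features (see context), and let $\mathcal R_1=\mathcal R_1(P_1)\subseteq\{1,\dots,m\}$ be the set of features selected for follow-up. Suppose that: (i) the selection rule $\mathcal R_1(\cdot)$ is stable; (ii) $l_{00}\le f_{00}$; (iii) the follow-up study $p$-values $P_{21},\dots,P_{2m}$ are either jointly independent or positive regression dependent on the subset of true null hypotheses (property PRDS); (iv) the vector $P_2$ is independent of the vector $P_1$. Then the procedure that declares as replicated exactly the features $i\in\mathcal R_1$ with $r$-value $r_i\le q$ has false discovery rate for replicability analysis at most $q$, i.e. $$E\left(\frac{R_{00}+R_{01}+R_{10}}{\max(R,1)}\right)\le q,$$ in each one of the following situations: 1. The primary study $p$-values $P_{11},\dots,P_{1m}$ are independent, and the $r$-values are the (unmodified) $r$-values. 2. The dependence among the primary study $p$-values is arbitrary, and the $r$-values are computed with $m$ replaced by $m^*=m\sum_{i=1}^m 1/i$ in the definitions of $e_j$ and $f_i$ (the quantity $c_1$ is unchanged). 3. The dependence among the primary study $p$-values is arbitrary; the selection rule is such that, for some fixed $t\in(0,1)$, the primary study $p$-values of all features selected for follow-up are at most $t$; and the $r$-values are computed with $c_1(x)$ replaced, in the definition of $e_j$, by $$\tilde c_1(x)=\max\Big\{a:\ a\Big(1+\sum_{i=1}^{\lceil tm/(ax)-1\rceil}\frac1i\Big)=c_1(x)\Big\},$$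 with the definitions of $e_j$ and $f_i$ otherwise unchanged, and with the $r$-value of $i\in\mathcal R_1$ defined as $r_i=\min\{x: f_i(x)\le x\}$ if a solution exists in $(0,1)$, and $r_i=1$ otherwise.
   Context: Setting. Each feature $j\in\{1,\dots,m\}$ has a null hypothesis in a primary study and one in a follow-up study, each either true (null) or false (non-null). The index set $\{1,\dots,m\}$ is partitioned into fixed sets $I_{00}$ (null in both studies), $I_{01}$ (null in the primary study only), $I_{10}$ (null in the follow-up study only), $I_{11}$ (non-null in both studies), and $f_{00}=|I_{00}|/m$. All $p$-values take values in $(0,1]$. A $p$-value $P$ of a true null hypothesis satisfies $\Pr(P\le u)\le u$ for all $u\in[0,1]$; so this holds for $P_{1j}$ when $j\in I_{00}\cup I_{01}$ and for $P_{2j}$ when $j\in I_{00}\cup I_{10}$. The set $\mathcal R_1$ is a function of the primary study $p$-values $P_1$; write $R_1=|\mathcal R_1|$. Only the follow-up $p$-values with indices in $\mathcal R_1$ are used by the procedure. Stable selection rule: for any $j\in\mathcal R_1$, fixing all primary study $p$-values except $P_{1j}$ and changing $P_{1j}$ so that $j$ is still selected does not change the set $\mathcal R_1$. PRDS for the follow-up study: for every $j\in I_{00}\cup I_{10}$ and every increasing set $D\subseteq\mathbb R^m$ (i.e. $x\in D$ and $y\ge x$ coordinatewise imply $y\in D$), $\Pr(P_2\in D\mid P_{2j}=u)$ is nondecreasing in $u$. $r$-values. Let $p_{1j},p_{2j}$, $j\in\mathcal R_1$, be the observed $p$-values. For $x\in(0,1)$ let $$c_1=c_1(x)=\frac{1-c_2}{1-l_{00}(1-c_2x)},\qquad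 e_j=e_j(x)=\max\left(\frac{p_{1j}}{c_1(x)},\ \frac{R_1\,p_{2j}}{m\,c_2}\right),\quad j\in\mathcal R_1,$$ $$f_i(x)=\min_{\{j\in\mathcal R_1:\ e_j\ge e_i\}}\frac{e_j\,m}{\mathrm{rank}(e_j)},\quad i\in\mathcal R_1,$$ where $\mathrm{rank}(e_j)=|\{k\in\mathcal R_1: e_k\le e_j\}|$ is the rank among the $e$-values (maximum rank for ties). The (unmodified) $r$-value $r_i$ of $i\in\mathcal R_1$ is the solution of $f_i(r_i)=r_i$ in $(0,1)$ if one exists (it is then unique), and $r_i=1$ otherwise. In situation 2 the $r$-value is defined by the same rule from the modified $f_i$. Counts. $R$ is the number of features declared replicated and $R_{ab}$ is the number of features in $I_{ab}$ declared replicated. A sum whose upper limit is $0$ is empty. *)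

theory Defs
  imports "HOL-Probability.Probability"
begin

text \<open>
  Features are the elements of a finite type \<open>'n\<close>, so that \<open>m = CARD('n)\<close> and vectors of
  p-values have type \<open>real ^ 'n\<close>.
\<close>

definition pval_vectors :: "(real ^ 'n) set" where
  "pval_vectors = {p. \<forall>j. 0 < p $ j \<and> p $ j \<le> 1}"

definition valid_null_pvalue :: "'a measure \<Rightarrow> ('a \<Rightarrow> real) \<Rightarrow> bool" where
  "valid_null_pvalue M P \<longleftrightarrow> (\<forall>u\<in>{0..1}. measure M {\<omega> \<in> space M. P \<omega> \<le> u} \<le> u)"

definition stable_rule :: "(real ^ 'n \<Rightarrow> 'n set) \<Rightarrow> bool" where
  "stable_rule sel \<longleftrightarrow>
     (\<forall>p\<in>pval_vectors. \<forall>p'\<in>pval_vectors. \<forall>j.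
        j \<in> sel p \<and> j \<in> sel p' \<and> (\<forall>k. k \<noteq> j \<longrightarrow> p' $ k = p $ k) \<longrightarrow> sel p' = sel p)"

definition increasing_set :: "(real ^ 'n) set \<Rightarrow> bool" where
  "increasing_set D \<longleftrightarrow> (\<forall>x\<in>D. \<forall>y. x \<le> y \<longrightarrow> y \<in> D)"

text \<open>
  The function \<open>u \<mapsto> Pr (P \<in> D | P\<^sub>j = u)\<close> is determined only up to null sets of the law of
  \<open>P\<^sub>j\<close>; that it is nondecreasing means that it has a nondecreasing version \<open>g\<close>.
\<close>

definition PRDS :: "'a measure \<Rightarrow> ('a \<Rightarrow> real ^ 'n) \<Rightarrow> 'n set \<Rightarrow> bool" where
  "PRDS M P J \<longleftrightarrow>
     (\<forall>j\<in>J. \<forall>D\<in>sets borel. increasing_set D \<longrightarrow>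
        (\<exists>g :: real \<Rightarrow> real. mono g \<and>
           (AE \<omega> in M.
              real_cond_exp M (vimage_algebra (space M) (\<lambda>\<omega>. P \<omega> $ j) borel)
                (indicator {\<omega> \<in> space M. P \<omega> \<in> D}) \<omega> = g (P \<omega> $ j))))"

definition c1 :: "real \<Rightarrow> real \<Rightarrow> real \<Rightarrow> real" where
  "c1 c2 l00 x = (1 - c2) / (1 - l00 * (1 - c2 * x))"

definition c1_tilde :: "real \<Rightarrow> real \<Rightarrow> real \<Rightarrow> real \<Rightarrow> real \<Rightarrow> real" where
  "c1_tilde m t c2 l00 x =
     (GREATEST a. 0 < a \<and>
        a * (1 + (\<Sum>i = 1..\<lceil>t * m / (a * x) - 1\<rceil>. 1 / real_of_int i)) = c1 c2 l00 x)"

text \<open>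
  In the next definitions \<open>m\<close> is a real parameter, the number of features or its modification
  \<open>m_star\<close> below; \<open>c\<close> is the function \<open>c1\<close> or \<open>c1_tilde\<close> of the argument \<open>x\<close>; \<open>S\<close> is the set of
  selected features.
\<close>

definition e_value ::
  "real \<Rightarrow> (real \<Rightarrow> real) \<Rightarrow> real \<Rightarrow> 'n set \<Rightarrow> real ^ 'n \<Rightarrow> real ^ 'n \<Rightarrow> real \<Rightarrow> 'n \<Rightarrow> real" where
  "e_value m c c2 S p1 p2 x j = max (p1 $ j / c x) (real (card S) * p2 $ j / (m * c2))"

definition rank_in :: "'n set \<Rightarrow> ('n \<Rightarrow> real) \<Rightarrow> 'n \<Rightarrow> nat" where
  "rank_in S e j = card {k \<in> S. e k \<le> e j}"

definition f_value ::
  "real \<Rightarrow> (real \<Rightarrow> real) \<Rightarrow> real \<Rightarrow> 'n set \<Rightarrow> real ^ 'n \<Rightarrow> real ^ 'n \<Rightarrow> 'n \<Rightarrow> real \<Rightarrow> real" where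
  "f_value m c c2 S p1 p2 i x =
     (let e = e_value m c c2 S p1 p2 x
      in Min ((\<lambda>j. e j * m / real (rank_in S e j)) ` {j \<in> S. e i \<le> e j}))"

definition r_solution :: "(real \<Rightarrow> real) \<Rightarrow> real" where
  "r_solution f =
     (if \<exists>x. 0 < x \<and> x < 1 \<and> f x = x then THE x. 0 < x \<and> x < 1 \<and> f x = x else 1)"

definition r_minimum :: "(real \<Rightarrow> real) \<Rightarrow> real" where
  "r_minimum f =
     (if \<exists>x. 0 < x \<and> x < 1 \<and> f x \<le> x then LEAST x. 0 < x \<and> x < 1 \<and> f x \<le> x else 1)"

definition m_star :: "nat \<Rightarrow> real" where
  "m_star m = real m * (\<Sum>i = 1..m. 1 / real i)"

definition r_value ::
  "real \<Rightarrow> real \<Rightarrow> 'n set \<Rightarrow> real ^ 'n \<Rightarrow> real ^ 'n \<Rightarrow> 'n \<Rightarrow> real" where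
  "r_value c2 l00 S p1 p2 i =
     r_solution (f_value (real CARD('n)) (c1 c2 l00) c2 S p1 p2 i)"

definition r_value_m_star ::
  "real \<Rightarrow> real \<Rightarrow> 'n set \<Rightarrow> real ^ 'n \<Rightarrow> real ^ 'n \<Rightarrow> 'n \<Rightarrow> real" where
  "r_value_m_star c2 l00 S p1 p2 i =
     r_solution (f_value (m_star CARD('n)) (c1 c2 l00) c2 S p1 p2 i)"

definition r_value_c1_tilde ::
  "real \<Rightarrow> real \<Rightarrow> real \<Rightarrow> 'n set \<Rightarrow> real ^ 'n \<Rightarrow> real ^ 'n \<Rightarrow> 'n \<Rightarrow> real" where
  "r_value_c1_tilde t c2 l00 S p1 p2 i =
     r_minimum
       (f_value (real CARD('n)) (c1_tilde (real CARD('n)) t c2 l00) c2 S p1 p2 i)"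

text \<open>\<open>r S p1 p2 i\<close> is the r-value of \<open>i \<in> S\<close> computed from the observed p-values.\<close>

definition declared ::
  "real \<Rightarrow> ('n set \<Rightarrow> real ^ 'n \<Rightarrow> real ^ 'n \<Rightarrow> 'n \<Rightarrow> real) \<Rightarrow> (real ^ 'n \<Rightarrow> 'n set)
    \<Rightarrow> real ^ 'n \<Rightarrow> real ^ 'n \<Rightarrow> 'n set" where
  "declared q r sel p1 p2 = {i \<in> sel p1. r (sel p1) p1 p2 i \<le> q}"

definition replicability_FDR ::
  "'a measure \<Rightarrow> 'n set \<Rightarrow> 'n set \<Rightarrow> 'n set \<Rightarrow> ('a \<Rightarrow> 'n set) \<Rightarrow> real" where
  "replicability_FDR M I00 I01 I10 Rep =
     (\<integral>\<omega>. real (card (Rep \<omega> \<inter> I00) + card (Rep \<omega> \<inter> I01) + card (Rep \<omega> \<inter> I10))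
           / real (max (card (Rep \<omega>)) 1) \<partial>M)"

end

theory Submission
  imports Defs
begin

text \<open>
  Since \<open>f\<^sub>i(x) = min {m max\<^bsub>j\<in>T\<^esub> e\<^sub>j(x) / |T|. i \<in> T \<subseteq> \<R>\<^sub>1}\<close>, the condition \<open>r\<^sub>i \<le> q\<close> says that \<open>i\<close> lies
  in the largest set \<open>D \<subseteq> \<R>\<^sub>1\<close> with \<open>p\<^sub>1\<^sub>j \<le> |D| a\<close> and \<open>p\<^sub>2\<^sub>j \<le> |D| c\<^sub>2 q / R\<^sub>1\<close> for all \<open>j \<in> D\<close>, where
  \<open>a = q c\<^sub>1(q) / m\<close> up to the modifications of situations 2 and 3. Every \<open>j \<in> D\<close> has the share
  \<open>1 / |D|\<close> of the false discovery proportion.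

  For fixed \<open>P\<^sub>1\<close>, the expected share of \<open>j \<in> I\<^sub>1\<^sub>0\<close> is at most \<open>c\<^sub>2 q / R\<^sub>1\<close>, because \<open>|D|\<close> is a decreasing
  function of \<open>P\<^sub>2\<close>. For fixed \<open>P\<^sub>2\<close>, the expected share of \<open>j \<in> I\<^sub>0\<^sub>1 \<union> I\<^sub>0\<^sub>0\<close> is at most \<open>\<gamma> = q c\<^sub>1(q) / m\<close>: under
  independence and stability \<open>|D|\<close> does not depend on \<open>P\<^sub>1\<^sub>j\<close> as long as \<open>j \<in> D\<close>, and under arbitrary
  dependence the argument of Benjamini and Yekutieli applies. If \<open>j \<in> I\<^sub>0\<^sub>0\<close>, then \<open>P\<^sub>2\<^sub>j \<le> c\<^sub>2 q\<close> is also
  needed for \<open>j \<in> D\<close>, which contributes a further factor \<open>c\<^sub>2 q\<close>. Altogether the rate is at most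
  \<open>c\<^sub>2 q + \<gamma> (|I\<^sub>0\<^sub>1| + c\<^sub>2 q |I\<^sub>0\<^sub>0|) \<le> q\<close>.
\<close>

section \<open>The set of replicated features\<close>

text \<open>For nonnegative \<open>a\<close> and \<open>b\<close> the thresholds grow with the
  cardinality, so a union of feasible sets \<open>T\<close> is again feasible. Taking the union
  yields the largest feasible set without a separate existence argument.\<close>

definition rep_set ::
  "real \<Rightarrow> real \<Rightarrow> 'n set \<Rightarrow> real ^ 'n \<Rightarrow> real ^ 'n \<Rightarrow> ('n::finite) set" where
  "rep_set a b S p1 p2 =
     \<Union>{T. T \<subseteq> S \<and> (\<forall>j\<in>T. p1 $ j \<le> real (card T) * a \<and> p2 $ j \<le> real (card T) * b)}"

lemma rep_set_subset: "rep_set a b S p1 p2 \<subseteq> S"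
  by (auto simp: rep_set_def)

lemma rep_set_greatest:
  assumes "T \<subseteq> S" "\<And>j. j \<in> T \<Longrightarrow> p1 $ j \<le> real (card T) * a"
    "\<And>j. j \<in> T \<Longrightarrow> p2 $ j \<le> real (card T) * b"
  shows "T \<subseteq> rep_set a b S p1 p2"
  using assms by (auto simp: rep_set_def)

text \<open>A witness \<open>T\<close> containing \<open>j\<close> is part of the union, so its
  thresholds are at most those of the union. Thus the union is itself feasible.\<close>

lemma rep_set_le:
  assumes "0 \<le> a" "0 \<le> b" "j \<in> rep_set a b S p1 p2"
  shows "p1 $ j \<le> real (card (rep_set a b S p1 p2)) * a"
    and "p2 $ j \<le> real (card (rep_set a b S p1 p2)) * b"
proof -
  obtain T where T: "T \<subseteq> S" "j \<in> T"
      "\<forall>j\<in>T. p1 $ j \<le> real (card T) * a \<and> p2 $ j \<le> real (card T) * b"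
    using assms(3) by (auto simp: rep_set_def)
  then have "T \<subseteq> rep_set a b S p1 p2"
    by (intro rep_set_greatest) auto
  then have "real (card T) \<le> real (card (rep_set a b S p1 p2))"
    by (simp add: card_mono)
  then have "real (card T) * a \<le> real (card (rep_set a b S p1 p2)) * a"
    "real (card T) * b \<le> real (card (rep_set a b S p1 p2)) * b"
    using assms by (simp_all add: mult_right_mono)
  then show "p1 $ j \<le> real (card (rep_set a b S p1 p2)) * a"
    "p2 $ j \<le> real (card (rep_set a b S p1 p2)) * b"
    using T(2,3) by (meson order_trans)+
qed

lemma rep_set_antimono:
  assumes "p2 \<le> p2'"
  shows "rep_set a b S p1 p2' \<subseteq> rep_set a b S p1 p2"
  using assms unfolding rep_set_def less_eq_vec_def by (blast intro: order_trans)

text \<open>The larger of the two sets is feasible for the other vector as well: only coordinate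
  \<open>j\<close> differs, and its value in that other vector already meets the threshold of the
  smaller set. Together with stability this freezes the number of replicated features while only the
  \<open>j\<close>-th primary p-value moves.\<close>

lemma card_rep_set_eq:
  assumes "0 \<le> a" "0 \<le> b" "\<And>k. k \<noteq> j \<Longrightarrow> p $ k = p' $ k"
    and j: "j \<in> rep_set a b S p p2" "j \<in> rep_set a b S p' p2"
  shows "card (rep_set a b S p p2) = card (rep_set a b S p' p2)"
proof -
  have *: "card (rep_set a b S p' p2) \<le> card (rep_set a b S p p2)"
    if "card (rep_set a b S p p2) \<le> card (rep_set a b S p' p2)"
      "\<And>k. k \<noteq> j \<Longrightarrow> p $ k = p' $ k"
      "j \<in> rep_set a b S p p2" "j \<in> rep_set a b S p' p2" for p p'
  proof (intro card_mono rep_set_greatest)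
    fix k assume k: "k \<in> rep_set a b S p' p2"
    show "p2 $ k \<le> real (card (rep_set a b S p' p2)) * b"
      using rep_set_le(2)[OF assms(1,2) k] .
    show "p $ k \<le> real (card (rep_set a b S p' p2)) * a"
    proof (cases "k = j")
      case True
      have "p $ j \<le> real (card (rep_set a b S p p2)) * a"
        by (rule rep_set_le(1)[OF assms(1,2) that(3)])
      also have "\<dots> \<le> real (card (rep_set a b S p' p2)) * a"
        using that(1) assms(1) by (simp add: mult_right_mono)
      finally show ?thesis using True by simp
    next
      case False
      then show ?thesis
        using that(2) rep_set_le(1)[OF assms(1,2) k] by simp
    qed
  qed (simp_all add: rep_set_subset)
  show ?thesis
    using *[of p p'] *[of p' p] assms by (metis le_antisym nat_le_linear)
qed

section \<open>The function \<open>f_value\<close> as a minimum over subsets\<close>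

text \<open>Among the sets \<open>T\<close> with maximal e-value \<open>e j\<close>, the quotient is
  smallest for the full lower level set, whose cardinality is the rank of \<open>j\<close>. In the
  subset form the index set does not depend on the e-values, which gives both the link to
  \<open>rep_set\<close> and continuity in the argument.\<close>

lemma Min_rank_eq_Min_subsets:
  fixes e :: "'n \<Rightarrow> real"
  assumes S: "finite S" "i \<in> S" and e: "\<And>j. j \<in> S \<Longrightarrow> 0 \<le> e j" and m: "0 \<le> m"
  shows "Min ((\<lambda>j. e j * m / real (rank_in S e j)) ` {j \<in> S. e i \<le> e j}) =
    Min ((\<lambda>T. Max (e ` T) * m / real (card T)) ` {T. T \<subseteq> S \<and> i \<in> T})" (is "Min ?A = Min ?B")
proof (rule antisym)
  have fin: "finite ?A" "finite ?B" "?A \<noteq> {}" "?B \<noteq> {}"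
    using S by auto
  show "Min ?A \<le> Min ?B"
  proof (rule Min.boundedI[OF fin(2,4)])
    fix y assume "y \<in> ?B"
    then obtain T where T: "T \<subseteq> S" "i \<in> T" and y: "y = Max (e ` T) * m / real (card T)"
      by auto
    have finT: "finite T" using T S finite_subset by auto
    then have "Max (e ` T) \<in> e ` T" using T by (intro Max_in) auto
    then obtain j where j: "j \<in> T" "e j = Max (e ` T)" by auto
    have le: "e k \<le> e j" if "k \<in> T" for k using j that finT by simp
    have "card T \<le> rank_in S e j"
      unfolding rank_in_def using T le S by (intro card_mono) auto
    moreover have "0 < card T" using T finT by (auto simp: card_gt_0_iff)
    ultimately have "e j * m / real (rank_in S e j) \<le> y"
      unfolding y j(2)[symmetric] using e[of j] j T m
      by (intro divide_left_mono mult_nonneg_nonneg) auto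
    moreover have "e j * m / real (rank_in S e j) \<in> ?A"
      using j(1) T le by (intro image_eqI[where x = j]) auto
    ultimately show "Min ?A \<le> y" using fin(1) by (meson Min_le order_trans)
  qed
  show "Min ?B \<le> Min ?A"
  proof (rule Min.boundedI[OF fin(1,3)])
    fix y assume "y \<in> ?A"
    then obtain j where j: "j \<in> S" "e i \<le> e j" and y: "y = e j * m / real (rank_in S e j)"
      by auto
    let ?T = "{k \<in> S. e k \<le> e j}"
    have "Max (e ` ?T) = e j" using S j by (intro Max_eqI) auto
    then have "y \<in> ?B" unfolding y rank_in_def using j S by (intro image_eqI[where x = ?T]) auto
    then show "Min ?B \<le> y" using fin(2) by simp
  qed
qed

lemma continuous_on_Min:
  fixes f :: "'b \<Rightarrow> real \<Rightarrow> real"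
  assumes "finite I" "I \<noteq> {}" "\<And>i. i \<in> I \<Longrightarrow> continuous_on A (f i)"
  shows "continuous_on A (\<lambda>x. Min ((\<lambda>i. f i x) ` I))"
  using assms by (induction rule: finite_ne_induct) (auto intro!: continuous_on_min)

lemma continuous_on_Max:
  fixes f :: "'b \<Rightarrow> real \<Rightarrow> real"
  assumes "finite I" "I \<noteq> {}" "\<And>i. i \<in> I \<Longrightarrow> continuous_on A (f i)"
  shows "continuous_on A (\<lambda>x. Max ((\<lambda>i. f i x) ` I))"
  using assms by (induction rule: finite_ne_induct) (auto intro!: continuous_on_max)

section \<open>The r-value threshold\<close>

context
  fixes m c2 :: real and c :: "real \<Rightarrow> real" and S :: "'n::finite set" and p1 p2 :: "real ^ 'n"
  assumes m: "0 < m" and c2: "0 < c2" "c2 < 1"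
    and p2: "\<And>j. 0 < p2 $ j"
    and c_pos: "\<And>x. 0 < x \<Longrightarrow> x < 1 \<Longrightarrow> 0 < c x"
begin

lemma f_value_eq_Min_subsets:
  assumes "i \<in> S" "0 < x" "x < 1"
  shows "f_value m c c2 S p1 p2 i x =
    Min ((\<lambda>T. Max (e_value m c c2 S p1 p2 x ` T) * m / real (card T)) ` {T. T \<subseteq> S \<and> i \<in> T})"
  unfolding f_value_def Let_def using m c2 p2
  by (intro Min_rank_eq_Min_subsets[OF _ assms(1)])
    (auto simp: e_value_def le_max_iff_disj less_imp_le)

lemma f_value_le_iff:
  assumes "i \<in> S" "0 < x" "x < 1"
  shows "f_value m c c2 S p1 p2 i x \<le> y \<longleftrightarrow>
    (\<exists>T. T \<subseteq> S \<and> i \<in> T \<and> (\<forall>j\<in>T. e_value m c c2 S p1 p2 x j \<le> real (card T) * y / m))"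
proof -
  have "Max (e_value m c c2 S p1 p2 x ` T) * m / real (card T) \<le> y \<longleftrightarrow>
      (\<forall>j\<in>T. e_value m c c2 S p1 p2 x j \<le> real (card T) * y / m)"
    if "T \<subseteq> S" "i \<in> T" for T
  proof -
    have "0 < card T" using that by (auto simp: card_gt_0_iff)
    then have "Max (e_value m c c2 S p1 p2 x ` T) * m / real (card T) \<le> y \<longleftrightarrow>
        Max (e_value m c c2 S p1 p2 x ` T) \<le> real (card T) * y / m"
      using m by (simp add: field_simps)
    then show ?thesis using that by (subst (asm) Max_le_iff) auto
  qed
  then show ?thesis
    unfolding f_value_eq_Min_subsets[OF assms] using assms(1)
    by (subst Min_le_iff) auto
qed

lemma f_value_less_iff:
  assumes "i \<in> S" "0 < x" "x < 1"
  shows "f_value m c c2 S p1 p2 i x < y \<longleftrightarrow>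
    (\<exists>T. T \<subseteq> S \<and> i \<in> T \<and> (\<forall>j\<in>T. e_value m c c2 S p1 p2 x j < real (card T) * y / m))"
proof -
  have "Max (e_value m c c2 S p1 p2 x ` T) * m / real (card T) < y \<longleftrightarrow>
      (\<forall>j\<in>T. e_value m c c2 S p1 p2 x j < real (card T) * y / m)"
    if "T \<subseteq> S" "i \<in> T" for T
  proof -
    have "0 < card T" using that by (auto simp: card_gt_0_iff)
    then have "Max (e_value m c c2 S p1 p2 x ` T) * m / real (card T) < y \<longleftrightarrow>
        Max (e_value m c c2 S p1 p2 x ` T) < real (card T) * y / m"
      using m by (simp add: field_simps)
    then show ?thesis using that by (subst (asm) Max_less_iff) auto
  qed
  then show ?thesis
    unfolding f_value_eq_Min_subsets[OF assms] using assms(1)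
    by (subst Min_less_iff) auto
qed

lemma e_value_le_iff:
  assumes "0 < x" "x < 1" "j \<in> S"
  shows "e_value m c c2 S p1 p2 x j \<le> y * x / m \<longleftrightarrow>
    p1 $ j \<le> y * (x * c x / m) \<and> p2 $ j \<le> y * (c2 * x / real (card S))"
proof -
  have "0 < card S" using assms by (auto simp: card_gt_0_iff)
  then show ?thesis
    unfolding e_value_def using m c2 assms c_pos[of x] by (simp add: field_simps)
qed

lemma e_value_less_iff:
  assumes "0 < x" "x < 1" "j \<in> S"
  shows "e_value m c c2 S p1 p2 x j < y * x / m \<longleftrightarrow>
    p1 $ j < y * (x * c x / m) \<and> p2 $ j < y * (c2 * x / real (card S))"
proof -
  have "0 < card S" using assms by (auto simp: card_gt_0_iff)
  then show ?thesis
    unfolding e_value_def using m c2 assms c_pos[of x] by (simp add: field_simps)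
qed

text \<open>For the bound \<open>x\<close> on the value at \<open>x\<close> itself, the threshold
  for the e-values splits into one for each study, and the existence of a set \<open>T\<close>
  through \<open>i\<close> is membership in the union of all such sets.\<close>

lemma f_value_le_self_iff:
  assumes "i \<in> S" "0 < x" "x < 1"
  shows "f_value m c c2 S p1 p2 i x \<le> x \<longleftrightarrow>
    i \<in> rep_set (x * c x / m) (c2 * x / real (card S)) S p1 p2"
proof -
  have "(\<forall>j\<in>T. e_value m c c2 S p1 p2 x j \<le> real (card T) * x / m) \<longleftrightarrow>
     (\<forall>j\<in>T. p1 $ j \<le> real (card T) * (x * c x / m)
            \<and> p2 $ j \<le> real (card T) * (c2 * x / real (card S)))" if "T \<subseteq> S" for T
    using that e_value_le_iff[OF assms(2,3)] by blast
  then show ?thesis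
    unfolding f_value_le_iff[OF assms] rep_set_def by blast
qed

text \<open>A set \<open>T\<close> that works at \<open>x\<close> works at \<open>y\<close> with
  strict inequalities, since both thresholds increase strictly. So \<open>f x \<le> x\<close>
  persists to the right, and \<open>f x = x\<close> has at most one solution.\<close>

lemma f_value_le_self_mono:
  assumes w: "\<And>x y. 0 < x \<Longrightarrow> x < y \<Longrightarrow> y < 1 \<Longrightarrow> x * c x < y * c y"
    and "i \<in> S" "0 < x" "x < y" "y < 1" "f_value m c c2 S p1 p2 i x \<le> x"
  shows "f_value m c c2 S p1 p2 i y < y"
proof -
  have x1: "x < 1" and y0: "0 < y" using assms by auto
  obtain T where T: "T \<subseteq> S" "i \<in> T"
      "\<forall>j\<in>T. e_value m c c2 S p1 p2 x j \<le> real (card T) * x / m"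
    using assms f_value_le_iff[of i x x] by auto
  have "0 < card T" "0 < card S" using T by (auto simp: card_gt_0_iff)
  moreover have "x * c x / m < y * c y / m" using w[of x y] assms m by (simp add: divide_strict_right_mono)
  moreover have "c2 * x / real (card S) < c2 * y / real (card S)"
    using c2 assms \<open>0 < card S\<close> by (simp add: divide_strict_right_mono)
  ultimately have *: "real (card T) * (x * c x / m) < real (card T) * (y * c y / m)"
    "real (card T) * (c2 * x / real (card S)) < real (card T) * (c2 * y / real (card S))"
    by (auto intro!: mult_strict_left_mono simp del: times_divide_eq_right)
  have "e_value m c c2 S p1 p2 y j < real (card T) * y / m" if "j \<in> T" for j
  proof -
    have jS: "j \<in> S" using T that by auto
    show ?thesis
      using T(3) that * unfolding e_value_less_iff[OF y0 \<open>y < 1\<close> jS]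
      using e_value_le_iff[OF \<open>0 < x\<close> x1 jS] by (meson le_less_trans)
  qed
  then show ?thesis
    using T by (subst f_value_less_iff) (use assms in auto)
qed

text \<open>At most \<open>card S\<close> features are replicated, so the follow-up threshold never
  exceeds \<open>c2 * x\<close>. This keeps the solutions of \<open>f x \<le> x\<close> away from
  \<open>0\<close>.\<close>

lemma f_value_le_self_imp:
  assumes "i \<in> S" "0 < x" "x < 1" "f_value m c c2 S p1 p2 i x \<le> x"
  shows "p2 $ i \<le> c2 * x"
proof -
  let ?D = "rep_set (x * c x / m) (c2 * x / real (card S)) S p1 p2"
  have D: "i \<in> ?D" using assms f_value_le_self_iff by blast
  have "0 < x * c x / m" "0 < card S" using assms m c_pos by (auto simp: card_gt_0_iff)
  then have "p2 $ i \<le> real (card ?D) * (c2 * x / real (card S))"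
    using assms c2 by (intro rep_set_le(2)[OF _ _ D]) (auto simp del: times_divide_eq_left)
  also have "\<dots> \<le> real (card S) * (c2 * x / real (card S))"
    using c2 assms by (intro mult_right_mono) (auto intro!: card_mono rep_set_subset)
  also have "\<dots> = c2 * x" using \<open>0 < card S\<close> by (simp add: card_gt_0_iff)
  finally show ?thesis .
qed

lemma continuous_on_f_value:
  assumes "i \<in> S" "continuous_on {0<..<1} c" "A \<subseteq> {0<..<1}"
  shows "continuous_on A (f_value m c c2 S p1 p2 i)"
proof -
  have c: "continuous_on A c" using assms continuous_on_subset by blast
  have c0: "c x \<noteq> 0" if "x \<in> A" for x using c_pos[of x] that assms by fastforce
  have "continuous_on A (\<lambda>x. Min ((\<lambda>T. Max ((\<lambda>j. e_value m c c2 S p1 p2 x j) ` T) * m / real (card T))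
      ` {T. T \<subseteq> S \<and> i \<in> T}))"
  proof (intro continuous_on_Min)
    fix T assume "T \<in> {T. T \<subseteq> S \<and> i \<in> T}"
    then have T: "T \<noteq> {}" "finite T" "card T \<noteq> 0" by auto
    have "continuous_on A (\<lambda>x. Max ((\<lambda>j. e_value m c c2 S p1 p2 x j) ` T))"
      using T unfolding e_value_def
      by (intro continuous_on_Max continuous_on_max continuous_intros c) (auto simp: c0)
    then show "continuous_on A (\<lambda>x. Max ((\<lambda>j. e_value m c c2 S p1 p2 x j) ` T) * m / real (card T))"
      using T by (intro continuous_intros) auto
  qed (use assms in auto)
  then show ?thesis
    by (rule continuous_on_eq) (use assms f_value_eq_Min_subsets in auto)
qed

lemma r_solution_f_value_le_iff:
  assumes i: "i \<in> S" and c: "continuous_on {0<..<1} c"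
    and w: "\<And>x y. 0 < x \<Longrightarrow> x < y \<Longrightarrow> y < 1 \<Longrightarrow> x * c x < y * c y"
    and q: "0 < q" "q < 1"
  shows "r_solution (f_value m c c2 S p1 p2 i) \<le> q \<longleftrightarrow> f_value m c c2 S p1 p2 i q \<le> q"
proof -
  let ?f = "f_value m c c2 S p1 p2 i"
  have mono: "?f y < y" if "0 < x" "x < y" "y < 1" "?f x \<le> x" for x y
    using f_value_le_self_mono[OF w i] that by blast
  have solution: "r_solution ?f = x" if "0 < x" "x < 1" "?f x = x" for x
  proof -
    have "(THE x. 0 < x \<and> x < 1 \<and> ?f x = x) = x"
    proof (rule the_equality)
      fix y assume "0 < y \<and> y < 1 \<and> ?f y = y"
      then show "y = x" using that mono[of x y] mono[of y x] by force
    qed (use that in auto)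
    then show ?thesis unfolding r_solution_def using that by auto
  qed
  show ?thesis
  proof
    assume *: "r_solution ?f \<le> q"
    \<comment> \<open>\<open>q < 1\<close> excludes the default r-value \<open>1\<close>.\<close>
    then obtain x where x: "0 < x" "x < 1" "?f x = x"
      using q unfolding r_solution_def by (auto split: if_splits)
    then have "x \<le> q" using solution * by simp
    then show "?f q \<le> q" using x mono[of x q] q by (cases "x = q") auto
  next
    assume *: "?f q \<le> q"
    \<comment> \<open>At \<open>a\<close> the function lies strictly above the identity, as
      otherwise \<open>a \<le> c2 * a\<close>; at \<open>q\<close> it does not, so the intermediate
      value theorem gives a fixed point in between.\<close>
    define a where "a = p2 $ i"
    have a0: "0 < a" using p2 by (simp add: a_def)
    have aq: "a < q"
    proof -
      have "a \<le> c2 * q" using f_value_le_self_imp[OF i q *] by (simp add: a_def)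
      also have "\<dots> < q" using c2 q by simp
      finally show ?thesis .
    qed
    have "\<not> ?f a \<le> a"
    proof
      assume "?f a \<le> a"
      then have "a \<le> c2 * a" using f_value_le_self_imp[OF i a0] aq q unfolding a_def by auto
      then show False using a0 c2 by simp
    qed
    moreover have "continuous_on {a..q} (\<lambda>x. x - ?f x)"
      using a0 q by (intro continuous_intros continuous_on_f_value[OF i c]) auto
    ultimately obtain x where "a \<le> x" "x \<le> q" "x - ?f x = 0"
      using IVT'[of "\<lambda>x. x - ?f x" a 0 q] * aq by auto
    then show "r_solution ?f \<le> q"
      using solution[of x] a0 q by auto
  qed
qed

text \<open>Without continuity of \<open>c\<close>, the least solution has to be found as an
  infimum. It is attained because \<open>x * c x\<close> cannot jump upwards immediately to the
  right of a point: a threshold violated at \<open>x\<close> stays violated just after it.\<close>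

lemma r_minimum_f_value_le_iff:
  assumes i: "i \<in> S"
    and w: "\<And>x y. 0 < x \<Longrightarrow> x < y \<Longrightarrow> y < 1 \<Longrightarrow> x * c x < y * c y"
    and usc: "\<And>x y. 0 < x \<Longrightarrow> x < 1 \<Longrightarrow> x * c x < y \<Longrightarrow> eventually (\<lambda>z. z * c z < y) (at_right x)"
    and q: "0 < q" "q < 1"
  shows "r_minimum (f_value m c c2 S p1 p2 i) \<le> q \<longleftrightarrow> f_value m c c2 S p1 p2 i q \<le> q"
proof -
  let ?f = "f_value m c c2 S p1 p2 i"
  define A where "A = {x. 0 < x \<and> x < 1 \<and> ?f x \<le> x}"
  have mono: "?f y < y" if "0 < x" "x < y" "y < 1" "?f x \<le> x" for x y
    using f_value_le_self_mono[OF w i] that by blast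
  have least: "(LEAST x. 0 < x \<and> x < 1 \<and> ?f x \<le> x) \<in> A" 
    "x \<in> A \<Longrightarrow> (LEAST x. 0 < x \<and> x < 1 \<and> ?f x \<le> x) \<le> x" if ne: "A \<noteq> {}" for x
  proof -
    define x0 where "x0 = Inf A"
    have lower: "p2 $ i \<le> x" if "x \<in> A" for x
    proof -
      have "p2 $ i \<le> c2 * x" "0 < x" using f_value_le_self_imp[OF i] that by (auto simp: A_def)
      moreover have "c2 * x \<le> x" using c2 \<open>0 < x\<close> by simp
      ultimately show ?thesis by linarith
    qed
    then have bdd: "bdd_below A" by (auto simp: bdd_below_def)
    have x0_le: "x0 \<le> x" if "x \<in> A" for x using that bdd by (simp add: x0_def cInf_lower)
    have x0_pos: "0 < x0"
      using cInf_greatest[OF ne lower] p2[of i] by (simp add: x0_def)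
    have x0_1: "x0 < 1" using ne x0_le by (force simp: A_def)
    have "x0 \<in> A"
    proof (rule ccontr)
      assume "x0 \<notin> A"
      then have not_le: "\<not> ?f x0 \<le> x0" using x0_pos x0_1 by (auto simp: A_def)
      \<comment> \<open>Every \<open>T\<close> through \<open>i\<close> is violated strictly at
        \<open>x0\<close> by some \<open>j\<close>, and the violation persists to the right; only
        finitely many \<open>T\<close> have to be treated at once.\<close>
      have "eventually (\<lambda>x. \<forall>T\<in>{T. T \<subseteq> S \<and> i \<in> T}. \<exists>j\<in>T. \<not> e_value m c c2 S p1 p2 x j \<le> real (card T) * x / m)
          (at_right x0)"
      proof (intro eventually_ball_finite ballI)
        fix T assume "T \<in> {T. T \<subseteq> S \<and> i \<in> T}"
        then have T: "T \<subseteq> S" "i \<in> T" "0 < card T" "0 < card S" by (auto simp: card_gt_0_iff)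
        then obtain j where j: "j \<in> T" "\<not> e_value m c c2 S p1 p2 x0 j \<le> real (card T) * x0 / m"
          using not_le f_value_le_iff[OF i x0_pos x0_1] by blast
        then have jS: "j \<in> S" using T by auto
        have ev: "eventually (\<lambda>x. x0 < x \<and> x < 1) (at_right x0)"
          using x0_1 eventually_at_right_less eventually_at_right_field
          by blast
        from j jS consider "real (card T) * (x0 * c x0 / m) < p1 $ j"
          | "real (card T) * (c2 * x0 / real (card S)) < p2 $ j"
          using e_value_le_iff[OF x0_pos x0_1 jS] by fastforce
        then have "eventually (\<lambda>x. \<not> e_value m c c2 S p1 p2 x j \<le> real (card T) * x / m) (at_right x0)"
        proof cases
          case 1
          then have "x0 * c x0 < p1 $ j * m / real (card T)" using T m by (simp add: field_simps)
          from usc[OF x0_pos x0_1 this] ev show ?thesis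
          proof eventually_elim
            case (elim x)
            then have "real (card T) * (x * c x / m) < p1 $ j" using T m by (simp add: field_simps)
            then show ?case using e_value_le_iff[of x j] elim x0_pos jS by fastforce
          qed
        next
          case 2
          have "((\<lambda>x. real (card T) * (c2 * x / real (card S))) \<longlongrightarrow> real (card T) * (c2 * x0 / real (card S))) (at_right x0)"
            by (intro tendsto_intros) (use T in auto)
          from order_tendstoD(2)[OF this 2] ev show ?thesis
          proof eventually_elim
            case (elim x)
            then show ?case using e_value_le_iff[of x j] x0_pos jS by fastforce
          qed
        qed
        then show "eventually (\<lambda>x. \<exists>j\<in>T. \<not> e_value m c c2 S p1 p2 x j \<le> real (card T) * x / m) (at_right x0)"
          by eventually_elim (use j in auto)
      qed auto
      then obtain b where b: "x0 < b" and
        none: "\<And>x. x0 < x \<Longrightarrow> x < b \<Longrightarrow> \<forall>T\<in>{T. T \<subseteq> S \<and> i \<in> T}. \<exists>j\<in>T. \<not> e_value m c c2 S p1 p2 x j \<le> real (card T) * x / m"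
        unfolding eventually_at_right_field by blast
      obtain x where x: "x \<in> A" "x < b"
        using b ne cInf_lessD[of A b] unfolding x0_def by blast
      moreover have "x0 < x" using x0_le[OF x(1)] x(1) \<open>x0 \<notin> A\<close> by (cases "x = x0") auto
      ultimately show False
        using none[of x] f_value_le_iff[OF i, of x x] unfolding A_def by blast
    qed
    then have "(LEAST x. 0 < x \<and> x < 1 \<and> ?f x \<le> x) = x0"
      using x0_le by (intro Least_equality) (auto simp: A_def)
    then show "(LEAST x. 0 < x \<and> x < 1 \<and> ?f x \<le> x) \<in> A" 
      "x \<in> A \<Longrightarrow> (LEAST x. 0 < x \<and> x < 1 \<and> ?f x \<le> x) \<le> x"
      using \<open>x0 \<in> A\<close> x0_le by auto
  qed
  have r: "r_minimum ?f = (if A \<noteq> {} then LEAST x. 0 < x \<and> x < 1 \<and> ?f x \<le> x else 1)"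
    unfolding r_minimum_def A_def by auto
  show ?thesis
  proof
    assume "r_minimum ?f \<le> q"
    then have "A \<noteq> {}" and le: "(LEAST x. 0 < x \<and> x < 1 \<and> ?f x \<le> x) \<le> q"
      using q unfolding r by (auto split: if_splits)
    define l where "l = (LEAST x. 0 < x \<and> x < 1 \<and> ?f x \<le> x)"
    have "l \<in> A" "l \<le> q" using least(1)[OF \<open>A \<noteq> {}\<close>] le by (simp_all add: l_def)
    then show "?f q \<le> q"
      using mono[of l q] q by (cases "l = q") (auto simp: A_def)
  next
    assume "?f q \<le> q"
    then have "q \<in> A" using q by (auto simp: A_def)
    then show "r_minimum ?f \<le> q" using least(2)[of q] unfolding r by auto
  qed
qed

end

section \<open>The constants \<open>c1\<close> and \<open>c1_tilde\<close>\<close>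

lemma c1_pos:
  assumes "0 < c2" "c2 < 1" "0 \<le> l00" "l00 < 1" "0 < x"
  shows "0 < 1 - l00 * (1 - c2 * x)" "0 < c1 c2 l00 x"
proof -
  have "l00 * (1 - c2 * x) \<le> l00" using assms by (simp add: mult_left_le)
  then show "0 < 1 - l00 * (1 - c2 * x)" using assms by simp
  then show "0 < c1 c2 l00 x" using assms by (simp add: c1_def)
qed

lemma continuous_on_c1:
  assumes "0 < c2" "c2 < 1" "0 \<le> l00" "l00 < 1"
  shows "continuous_on {0<..} (c1 c2 l00)"
proof -
  have "1 - l00 * (1 - c2 * x) \<noteq> 0" if "x \<in> {0<..}" for x
    using c1_pos(1)[OF assms, of x] that by auto
  then show ?thesis
    unfolding c1_def by (intro continuous_intros) auto
qed

lemma times_c1_strict_mono: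
  assumes "0 < c2" "c2 < 1" "0 \<le> l00" "l00 < 1" "0 < x" "x < y"
  shows "x * c1 c2 l00 x < y * c1 c2 l00 y"
proof -
  define d where "d = (\<lambda>x. 1 - l00 * (1 - c2 * x))"
  have d: "0 < d x" "0 < d y"
    using c1_pos(1)[OF assms(1-4)] assms(5,6) by (auto simp: d_def)
  \<comment> \<open>After cross-multiplication the terms in \<open>x * y\<close> cancel and this
    difference remains.\<close>
  have "0 < (y - x) * (1 - l00)" using assms by simp
  then have "x * d y < y * d x" by (simp add: d_def algebra_simps)
  then have "x / d x < y / d y" using d by (simp add: field_simps)
  then have "x / d x * (1 - c2) < y / d y * (1 - c2)"
    using assms by (intro mult_strict_right_mono) auto
  then show ?thesis by (simp add: c1_def d_def)
qed

section \<open>Harmonic sums and the closed form of \<open>c1_tilde\<close>\<close>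

text \<open>A crude sublinear bound, which makes the index in \<open>c1_tilde\<close> finite. The
  increment \<open>1 / (n + 1)\<close> is at most
  \<open>2 * (sqrt (n + 1) - sqrt n)\<close>.\<close>

lemma harm_le_sqrt: "(harm n :: real) \<le> 2 * sqrt (real n)"
proof (induction n)
  case (Suc n)
  define a b where "a = sqrt (real n)" and "b = sqrt (real (Suc n))"
  have ab: "0 \<le> a" "a \<le> b" "0 < b" and sq: "b * b = a * a + 1" "b * b = real (Suc n)"
    by (auto simp: a_def b_def)
  have "1 = (b - a) * (b + a)" using sq by (simp add: algebra_simps)
  also have "\<dots> \<le> (b - a) * (2 * b)" using ab by (intro mult_left_mono) auto
  also have "\<dots> \<le> (b - a) * (2 * (b * b))"
    using ab mult_left_mono[of 1 b b] by (intro mult_left_mono) (auto simp: b_def)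
  finally have "1 / (b * b) \<le> 2 * (b - a)"
    using ab by (simp add: field_simps)
  then have "inverse (real (Suc n)) \<le> 2 * (b - a)"
    unfolding sq(2) by (simp add: inverse_eq_divide)
  then show ?case using Suc by (simp add: harm_Suc a_def b_def)
qed (simp add: harm_expand)

lemma sum_inverse_int_eq_harm: "(\<Sum>i = 1..int n. 1 / real_of_int i) = harm n"
proof (induction n)
  case (Suc n)
  have "{1..int (Suc n)} = insert (int (Suc n)) {1..int n}" by auto
  then show ?case using Suc by (simp add: harm_Suc inverse_eq_divide)
qed (simp add: harm_expand)

text \<open>
  For \<open>g = x c\<^sub>1(x)\<close>, the index below is the smallest possible value of the summation bound
  \<open>\<lceil>tm/(ax) - 1\<rceil>\<close> over the solutions \<open>a\<close> in the definition of \<open>c1_tilde\<close>.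
\<close>

definition tilde_index :: "real \<Rightarrow> real \<Rightarrow> nat" where
  "tilde_index tm g = (LEAST k. tm * (1 + harm k) \<le> g * (real k + 1))"

lemma ex_tilde_index:
  assumes "0 < tm" "0 < g"
  shows "\<exists>k. tm * (1 + harm k) \<le> g * (real k + 1)"
proof -
  \<comment> \<open>Then \<open>sqrt k\<close> is at least \<open>3 * tm / g\<close>, while
    \<open>1 + harm k\<close> is at most \<open>3 * sqrt k\<close>; the successor ensures
    \<open>1 \<le> k\<close>.\<close>
  define k where "k = Suc (nat \<lceil>(3 * tm / g)\<^sup>2\<rceil>)"
  have k: "(3 * tm / g)\<^sup>2 \<le> real k" "1 \<le> real k" unfolding k_def by linarith+
  have "3 * tm / g \<le> sqrt (real k)" "1 \<le> sqrt (real k)"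
    using k real_le_rsqrt by auto
  then have s: "3 * tm \<le> g * sqrt (real k)" using assms by (simp add: field_simps)
  have "tm * (1 + harm k) \<le> tm * (3 * sqrt (real k))"
    using add_mono[OF \<open>1 \<le> sqrt (real k)\<close> harm_le_sqrt[of k]] assms by (intro mult_left_mono) auto
  also have "\<dots> = 3 * tm * sqrt (real k)" by simp
  also have "\<dots> \<le> (g * sqrt (real k)) * sqrt (real k)"
    using s by (intro mult_right_mono) auto
  also have "\<dots> \<le> g * (real k + 1)" using assms by simp
  finally show ?thesis by blast
qed

lemma tilde_index:
  assumes "0 < tm" "0 < g"
  shows "tm * (1 + harm (tilde_index tm g)) \<le> g * (real (tilde_index tm g) + 1)"
  unfolding tilde_index_def using ex_tilde_index[OF assms] by (rule LeastI_ex)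

lemma tilde_index_le: "tm * (1 + harm k) \<le> g * (real k + 1) \<Longrightarrow> tilde_index tm g \<le> k"
  unfolding tilde_index_def by (rule Least_le)

lemma tilde_index_antimono:
  assumes "0 < tm" "0 < g" "g \<le> g'"
  shows "tilde_index tm g' \<le> tilde_index tm g"
proof (rule tilde_index_le)
  note tilde_index[OF assms(1,2)]
  also have "g * (real (tilde_index tm g) + 1) \<le> g' * (real (tilde_index tm g) + 1)"
    using assms by (intro mult_right_mono) auto
  finally show "tm * (1 + harm (tilde_index tm g)) \<le> g' * (real (tilde_index tm g) + 1)" .
qed

lemma one_plus_harm_pos: "(0::real) < 1 + harm k"
  using harm_nonneg[of k, where 'a = real] by linarith

context
  fixes m t c2 l00 :: real
  assumes m: "0 < m" and t: "0 < t" and c2: "0 < c2" "c2 < 1" and l00: "0 \<le> l00" "l00 < 1"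
begin

text \<open>A solution with summation bound \<open>k\<close> equals
  \<open>c1 c2 l00 x / (1 + harm k)\<close>, so the greatest solution is the one with the least
  bound. The least admissible index does occur as the bound of its own candidate, and no solution
  has a smaller one.\<close>

lemma c1_tilde_eq:
  assumes x: "0 < x"
  shows "c1_tilde m t c2 l00 x =
    c1 c2 l00 x / (1 + harm (tilde_index (t * m) (x * c1 c2 l00 x)))"
proof -
  define k where "k = tilde_index (t * m) (x * c1 c2 l00 x)"
  define a where "a = c1 c2 l00 x / (1 + harm k)"
  have c: "0 < c1 c2 l00 x" by (rule c1_pos(2)[OF c2 l00 x])
  have tm: "0 < t * m" using t m by simp
  have a: "0 < a" using c one_plus_harm_pos by (simp add: a_def)
  have sum: "(\<Sum>i = 1..\<lceil>t * m / (b * x) - 1\<rceil>. 1 / real_of_int i)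
      = harm (nat \<lceil>t * m / (b * x) - 1\<rceil>)" if "0 < b" for b
  proof -
    have "0 < t * m / (b * x)" using that tm x by simp
    then have "0 \<le> \<lceil>t * m / (b * x) - 1\<rceil>" by linarith
    then have "\<lceil>t * m / (b * x) - 1\<rceil> = int (nat \<lceil>t * m / (b * x) - 1\<rceil>)" by simp
    then show ?thesis using sum_inverse_int_eq_harm by metis
  qed
  \<comment> \<open>The upper estimate is the inequality that defines the index; for positive
    \<open>k\<close> the lower one is its failure at the predecessor of \<open>k\<close>.\<close>
  have "\<lceil>t * m / (a * x) - 1\<rceil> = int k"
  proof (rule ceiling_unique)
    have ratio: "t * m / (a * x) = t * m * (1 + harm k) / (x * c1 c2 l00 x)"
      by (simp add: a_def mult.commute)
    have "t * m * (1 + harm k) \<le> (x * c1 c2 l00 x) * (real k + 1)"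
      unfolding k_def using tilde_index[OF tm, of "x * c1 c2 l00 x"] c x by simp
    then show "t * m / (a * x) - 1 \<le> real_of_int (int k)"
      unfolding ratio using c x by (simp add: field_simps)
    show "real_of_int (int k) - 1 < t * m / (a * x) - 1"
    proof (cases k)
      case 0
      then show ?thesis using a x tm by simp
    next
      case (Suc k')
      have "\<not> t * m * (1 + harm k') \<le> (x * c1 c2 l00 x) * (real k' + 1)"
        using tilde_index_le[of "t * m" k' "x * c1 c2 l00 x"] Suc k_def by auto
      moreover have "t * m * (1 + harm k') \<le> t * m * (1 + harm k)"
        using tm Suc harm_mono[of k' k, where 'a = real] by (intro mult_left_mono) auto
      ultimately have "(x * c1 c2 l00 x) * real k < t * m * (1 + harm k)"
        using Suc by (simp add: add.commute)
      then have "real k < t * m / (a * x)"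
        unfolding ratio using c x by (simp add: field_simps)
      then show ?thesis by simp
    qed
  qed
  then have eq: "a * (1 + (\<Sum>i = 1..\<lceil>t * m / (a * x) - 1\<rceil>. 1 / real_of_int i)) = c1 c2 l00 x"
    using sum_inverse_int_eq_harm[of k] one_plus_harm_pos[of k] by (simp add: a_def)
  have "c1_tilde m t c2 l00 x = a"
    unfolding c1_tilde_def
  proof (rule Greatest_equality)
    show "0 < a \<and> a * (1 + (\<Sum>i = 1..\<lceil>t * m / (a * x) - 1\<rceil>. 1 / real_of_int i)) = c1 c2 l00 x"
      using a eq by simp
    fix b assume b: "0 < b \<and> b * (1 + (\<Sum>i = 1..\<lceil>t * m / (b * x) - 1\<rceil>. 1 / real_of_int i)) = c1 c2 l00 x"
    \<comment> \<open>The summation bound of any solution \<open>b\<close> satisfies the inequality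
      of which \<open>k\<close> is the least solution.\<close>
    define l where "l = nat \<lceil>t * m / (b * x) - 1\<rceil>"
    have bl: "b * (1 + harm l) = c1 c2 l00 x" using b sum[of b] by (simp add: l_def)
    have "t * m / (b * x) \<le> real l + 1" unfolding l_def by linarith
    then have "t * m \<le> (real l + 1) * (b * x)" using b x by (simp add: field_simps)
    then have "t * m * (1 + harm l) \<le> (real l + 1) * (b * x) * (1 + harm l)"
      using one_plus_harm_pos[of l] by (intro mult_right_mono) auto
    also have "\<dots> = (x * c1 c2 l00 x) * (real l + 1)"
      unfolding bl[symmetric] by (simp add: algebra_simps)
    finally have "k \<le> l" unfolding k_def by (rule tilde_index_le)
    then have "b * (1 + harm k) \<le> b * (1 + harm l)" using b by (simp add: harm_mono)
    then show "b \<le> a" unfolding a_def using bl one_plus_harm_pos[of k] by (simp add: field_simps)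
  qed
  then show ?thesis by (simp add: a_def k_def)
qed

lemma c1_tilde_pos: "0 < x \<Longrightarrow> 0 < c1_tilde m t c2 l00 x"
  using c1_tilde_eq c1_pos(2)[OF c2 l00] one_plus_harm_pos by simp

text \<open>Increasing \<open>x\<close> raises the numerator \<open>x * c1 c2 l00 x\<close> and can
  only lower the index, hence the harmonic number in the denominator.\<close>

lemma times_c1_tilde_strict_mono:
  assumes "0 < x" "x < y"
  shows "x * c1_tilde m t c2 l00 x < y * c1_tilde m t c2 l00 y"
proof -
  let ?g = "\<lambda>x. x * c1 c2 l00 x" and ?k = "\<lambda>x. tilde_index (t * m) (x * c1 c2 l00 x)"
  have g: "?g x < ?g y" "0 < ?g x" "0 < ?g y"
    using times_c1_strict_mono[OF c2 l00 assms] c1_pos(2)[OF c2 l00] assms by auto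
  then have "?k y \<le> ?k x" using t m by (intro tilde_index_antimono) auto
  then have "?g x / (1 + harm (?k x)) \<le> ?g x / (1 + harm (?k y))"
    using g one_plus_harm_pos[of "?k y"] one_plus_harm_pos[of "?k x"]
    by (intro divide_left_mono) (auto simp: harm_mono)
  also have "\<dots> < ?g y / (1 + harm (?k y))"
    using g one_plus_harm_pos by (simp add: divide_strict_right_mono)
  finally show ?thesis using assms by (simp add: c1_tilde_eq)
qed

text \<open>The finitely many indices below the current one are excluded by strict inequalities,
  which persist slightly to the right of \<open>x\<close>, so the index does not drop there. Hence
  the function is bounded by a continuous one with the same value at \<open>x\<close>.\<close>

lemma times_c1_tilde_usc_at_right:
  assumes x: "0 < x" and y: "x * c1_tilde m t c2 l00 x < y"
  shows "eventually (\<lambda>z. z * c1_tilde m t c2 l00 z < y) (at_right x)"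
proof -
  let ?g = "\<lambda>x. x * c1 c2 l00 x"
  define k where "k = tilde_index (t * m) (?g x)"
  have "isCont (c1 c2 l00) x"
    using continuous_on_c1[OF c2 l00] x by (auto simp: continuous_on_eq_continuous_at)
  then have "isCont ?g x" by (intro continuous_intros)
  then have lim: "(?g \<longlongrightarrow> ?g x) (at_right x)"
    unfolding isCont_def by (rule filterlim_mono) (auto simp: at_le)
  have "eventually (\<lambda>z. \<forall>l\<in>{..<k}. ?g z * (real l + 1) < t * m * (1 + harm l)) (at_right x)"
  proof (intro eventually_ball_finite ballI)
    fix l assume "l \<in> {..<k}"
    then have "\<not> t * m * (1 + harm l) \<le> ?g x * (real l + 1)"
      using tilde_index_le[of "t * m" l "?g x"] unfolding k_def by auto
    then have "?g x * (real l + 1) < t * m * (1 + harm l)" by simp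
    then show "eventually (\<lambda>z. ?g z * (real l + 1) < t * m * (1 + harm l)) (at_right x)"
      by (intro order_tendstoD(2)[OF tendsto_mult_right[OF lim]])
  qed auto
  moreover have "eventually (\<lambda>z. ?g z / (1 + harm k) < y) (at_right x)"
    using y x one_plus_harm_pos[of k] unfolding c1_tilde_eq[OF x]
    by (intro order_tendstoD(2)[OF tendsto_divide[OF lim tendsto_const]]) (auto simp: k_def)
  moreover have "eventually (\<lambda>z. x < z) (at_right x)" by (rule eventually_at_right_less)
  ultimately show ?thesis
  proof eventually_elim
    case (elim z)
    have z: "0 < z" "0 < ?g z" using elim x c1_pos(2)[OF c2 l00, of z] by auto
    have "k \<le> tilde_index (t * m) (?g z)"
    proof (rule ccontr)
      assume "\<not> k \<le> tilde_index (t * m) (?g z)"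
      then have "?g z * (real (tilde_index (t * m) (?g z)) + 1)
          < t * m * (1 + harm (tilde_index (t * m) (?g z)))"
        using elim(1) by auto
      then show False
        using tilde_index[of "t * m" "?g z"] t m z by auto
    qed
    then have "?g z / (1 + harm (tilde_index (t * m) (?g z))) \<le> ?g z / (1 + harm k)"
      using z one_plus_harm_pos[of k] one_plus_harm_pos[of "tilde_index (t * m) (?g z)"]
      by (intro divide_left_mono) (auto simp: harm_mono)
    then show ?case using elim(2) z by (simp add: c1_tilde_eq)
  qed
qed

text \<open>\<open>K\<close> is one more than the summation bound \<open>k\<close>. With
  \<open>a = x * c1_tilde m t c2 l00 x / m\<close>, the levels \<open>real i * a\<close> up to
  \<open>i = K\<close> reach \<open>t\<close>, and the price \<open>harm K\<close> is at most the
  factor \<open>1 + harm k\<close> by which \<open>c1_tilde\<close> is smaller than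
  \<open>c1\<close>.\<close>

lemma c1_tilde_harm_bound:
  assumes "0 < x"
  obtains K where "0 < K" "t \<le> real K * (x * c1_tilde m t c2 l00 x / m)"
    "x * c1_tilde m t c2 l00 x / m * harm K \<le> x * c1 c2 l00 x / m"
proof -
  let ?g = "x * c1 c2 l00 x"
  define k where "k = tilde_index (t * m) ?g"
  have g: "0 < ?g" using c1_pos(2)[OF c2 l00 assms] assms by simp
  have h: "0 < 1 + (harm k :: real)" by (rule one_plus_harm_pos)
  have w: "x * c1_tilde m t c2 l00 x = ?g / (1 + harm k)"
    using assms by (simp add: c1_tilde_eq k_def)
  have "t * m * (1 + harm k) \<le> ?g * (real k + 1)"
    unfolding k_def using g t m by (intro tilde_index) auto
  then have "t \<le> ?g * (real k + 1) / (m * (1 + harm k))"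
    using h m by (subst pos_le_divide_eq) (auto simp: mult.assoc)
  then have 1: "t \<le> real (Suc k) * (x * c1_tilde m t c2 l00 x / m)"
    unfolding w using m h by (simp add: field_simps)
  have "harm (Suc k) \<le> 1 + (harm k :: real)" by (simp add: harm_Suc inverse_eq_divide)
  then have "?g / (1 + harm k) / m * harm (Suc k) \<le> ?g / (1 + harm k) / m * (1 + harm k)"
    using g h m by (intro mult_left_mono) auto
  also have "\<dots> = ?g / m" using h by simp
  finally show ?thesis using 1 that[of "Suc k"] unfolding w by simp
qed

end

section \<open>Independence and lower tail dependence\<close>

lemma borel_measurable_vec_nth [measurable (raw)]:
  fixes f :: "'a \<Rightarrow> real ^ 'n"
  assumes "f \<in> borel_measurable M"
  shows "(\<lambda>x. f x $ j) \<in> borel_measurable M"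
  by (rule measurable_compose[OF assms borel_measurable_nth])

lemma measurable_finite_setI:
  fixes F :: "'a \<Rightarrow> 'n::finite set"
  assumes [measurable]: "\<And>j. Measurable.pred M (\<lambda>\<omega>. j \<in> F \<omega>)"
  shows "F \<in> measurable M (count_space UNIV)"
  unfolding measurable_count_space_eq2[OF finite]
proof (intro conjI ballI)
  fix D :: "'n set"
  have "F -` {D} \<inter> space M = {\<omega> \<in> space M. \<forall>j\<in>UNIV. j \<in> F \<omega> \<longleftrightarrow> j \<in> D}" by auto
  also have "\<dots> \<in> sets M" by measurable
  finally show "F -` {D} \<inter> space M \<in> sets M" .
qed auto

lemma measurable_rep_set:
  fixes P1 P2 :: "'a \<Rightarrow> real ^ 'n::finite"
  assumes [measurable]: "S \<in> measurable M (count_space UNIV)"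
    "P1 \<in> borel_measurable M" "P2 \<in> borel_measurable M"
  shows "(\<lambda>\<omega>. rep_set a (b (S \<omega>)) (S \<omega>) (P1 \<omega>) (P2 \<omega>)) \<in> measurable M (count_space UNIV)"
proof (rule measurable_finite_setI)
  fix j
  have [measurable]: "(\<lambda>\<omega>. b (S \<omega>)) \<in> borel_measurable M"
    by (rule measurable_compose[OF assms(1)]) simp
  have [measurable]: "Measurable.pred M (\<lambda>\<omega>. T \<subseteq> S \<omega>)" for T
    by (rule measurable_compose[OF assms(1)]) simp
  have "j \<in> rep_set a (b (S \<omega>)) (S \<omega>) (P1 \<omega>) (P2 \<omega>) \<longleftrightarrow>
     (\<exists>T\<in>Collect (\<lambda>T. j \<in> T). T \<subseteq> S \<omega> \<and>
        (\<forall>k\<in>T. P1 \<omega> $ k \<le> real (card T) * a \<and> P2 \<omega> $ k \<le> real (card T) * b (S \<omega>)))" for \<omega>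
    by (auto simp: rep_set_def)
  then show "Measurable.pred M (\<lambda>\<omega>. j \<in> rep_set a (b (S \<omega>)) (S \<omega>) (P1 \<omega>) (P2 \<omega>))"
    by simp measurable
qed

section \<open>Shares of the false discovery proportion\<close>

text \<open>For empty \<open>D\<close> the value is \<open>0\<close>, in agreement with the
  denominator \<open>max (card D) 1\<close> of the proportion.\<close>

definition share :: "'n \<Rightarrow> 'n::finite set \<Rightarrow> real" where
  "share j D = indicator D j / real (card D)"

lemma share_nonneg: "0 \<le> share j D"
  by (simp add: share_def)

lemma share_notin: "j \<notin> D \<Longrightarrow> share j D = 0"
  by (simp add: share_def)

lemma replicability_FDR_eq:
  fixes Rep :: "'a \<Rightarrow> 'n::finite set"
  assumes "I00 \<inter> I01 = {}" "I00 \<inter> I10 = {}" "I01 \<inter> I10 = {}"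
  shows "replicability_FDR M I00 I01 I10 Rep =
    (\<integral>\<omega>. (\<Sum>j\<in>I00. share j (Rep \<omega>)) + (\<Sum>j\<in>I01. share j (Rep \<omega>)) + (\<Sum>j\<in>I10. share j (Rep \<omega>)) \<partial>M)"
proof -
  have "real (card (D \<inter> I)) / real (max (card D) 1) = (\<Sum>j\<in>I. share j D)" for D I :: "'n set"
  proof (cases "D = {}")
    case False
    then have "max (card D) 1 = card D" by (simp add: Suc_leI card_gt_0_iff max_absorb1)
    then show ?thesis
      unfolding share_def sum_divide_distrib[symmetric]
      by (simp add: indicator_def Int_commute flip: sum.inter_filter)
  qed (simp add: share_def)
  then show ?thesis
    unfolding replicability_FDR_def by (simp add: add_divide_distrib)
qed

section \<open>Tonelli for independent variables and resampling of one coordinate\<close>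

context prob_space
begin

text \<open>The joint law is a product, so Tonelli applies in either order. Integrating over a
  second copy of the sample point expresses conditioning on one variable without conditional
  expectations.\<close>

lemma nn_integral_indep_pair:
  assumes indep: "indep_var S X T Y" and h: "h \<in> borel_measurable (S \<Otimes>\<^sub>M T)"
  shows "(\<integral>\<^sup>+\<omega>. h (X \<omega>, Y \<omega>) \<partial>M) = (\<integral>\<^sup>+\<omega>. \<integral>\<^sup>+\<omega>'. h (X \<omega>, Y \<omega>') \<partial>M \<partial>M)"
    and "(\<integral>\<^sup>+\<omega>. h (X \<omega>, Y \<omega>) \<partial>M) = (\<integral>\<^sup>+\<omega>'. \<integral>\<^sup>+\<omega>. h (X \<omega>, Y \<omega>') \<partial>M \<partial>M)"
proof -
  note h [measurable]
  have X [measurable]: "X \<in> measurable M S" and Y [measurable]: "Y \<in> measurable M T"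
    and eq: "distr M S X \<Otimes>\<^sub>M distr M T Y = distr M (S \<Otimes>\<^sub>M T) (\<lambda>\<omega>. (X \<omega>, Y \<omega>))"
    using indep unfolding indep_var_distribution_eq by auto
  interpret X: prob_space "distr M S X" by (rule prob_space_distr) simp
  interpret Y: prob_space "distr M T Y" by (rule prob_space_distr) simp
  interpret XY: pair_sigma_finite "distr M S X" "distr M T Y" ..
  have [measurable]: "h \<in> borel_measurable (distr M S X \<Otimes>\<^sub>M distr M T Y)" by simp
  have "(\<integral>\<^sup>+\<omega>. h (X \<omega>, Y \<omega>) \<partial>M) = integral\<^sup>N (distr M S X \<Otimes>\<^sub>M distr M T Y) h"
    unfolding eq by (simp add: nn_integral_distr)
  moreover have "\<dots> = (\<integral>\<^sup>+x. \<integral>\<^sup>+y. h (x, y) \<partial>distr M T Y \<partial>distr M S X)"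
    by (rule Y.nn_integral_fst[symmetric]) simp
  moreover have "\<dots> = (\<integral>\<^sup>+\<omega>. \<integral>\<^sup>+y. h (X \<omega>, y) \<partial>distr M T Y \<partial>M)"
    by (rule nn_integral_distr) measurable
  moreover have "\<dots> = (\<integral>\<^sup>+\<omega>. \<integral>\<^sup>+\<omega>'. h (X \<omega>, Y \<omega>') \<partial>M \<partial>M)"
    by (intro nn_integral_cong nn_integral_distr) 
      (auto intro!: measurable_compose[OF measurable_Pair1' h] measurable_compose[OF measurable_Pair2' h]
        measurable_space[OF X] measurable_space[OF Y])
  moreover have "integral\<^sup>N (distr M S X \<Otimes>\<^sub>M distr M T Y) h
      = (\<integral>\<^sup>+y. \<integral>\<^sup>+x. h (x, y) \<partial>distr M S X \<partial>distr M T Y)"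
    by (rule XY.nn_integral_snd[symmetric]) simp
  moreover have "\<dots> = (\<integral>\<^sup>+\<omega>'. \<integral>\<^sup>+x. h (x, Y \<omega>') \<partial>distr M S X \<partial>M)"
    by (rule nn_integral_distr) measurable
  moreover have "\<dots> = (\<integral>\<^sup>+\<omega>'. \<integral>\<^sup>+\<omega>. h (X \<omega>, Y \<omega>') \<partial>M \<partial>M)"
    by (intro nn_integral_cong nn_integral_distr) 
      (auto intro!: measurable_compose[OF measurable_Pair1' h] measurable_compose[OF measurable_Pair2' h]
        measurable_space[OF X] measurable_space[OF Y])
  ultimately show "(\<integral>\<^sup>+\<omega>. h (X \<omega>, Y \<omega>) \<partial>M) = (\<integral>\<^sup>+\<omega>. \<integral>\<^sup>+\<omega>'. h (X \<omega>, Y \<omega>') \<partial>M \<partial>M)"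
    "(\<integral>\<^sup>+\<omega>. h (X \<omega>, Y \<omega>) \<partial>M) = (\<integral>\<^sup>+\<omega>'. \<integral>\<^sup>+\<omega>. h (X \<omega>, Y \<omega>') \<partial>M \<partial>M)"
    by simp_all
qed

end

definition vec_upd :: "real ^ 'n \<Rightarrow> 'n \<Rightarrow> real \<Rightarrow> real ^ 'n" where
  "vec_upd p j x = (\<chi> k. if k = j then x else p $ k)"

lemma vec_upd_nth [simp]: "vec_upd p j x $ k = (if k = j then x else p $ k)"
  by (simp add: vec_upd_def)

lemma borel_measurable_vecI:
  fixes f :: "'a \<Rightarrow> real ^ 'n"
  assumes [measurable]: "\<And>j. (\<lambda>x. f x $ j) \<in> borel_measurable M"
  shows "f \<in> borel_measurable M"
proof (subst borel_measurable_euclidean_space, intro ballI)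
  fix i :: "real ^ 'n" assume "i \<in> Basis"
  show "(\<lambda>x. f x \<bullet> i) \<in> borel_measurable M"
    unfolding inner_vec_def by measurable
qed

lemma borel_measurable_vec_upd [measurable (raw)]:
  assumes [measurable]: "f \<in> borel_measurable M" "g \<in> borel_measurable M"
  shows "(\<lambda>x. vec_upd (f x) j (g x)) \<in> borel_measurable M"
  by (rule borel_measurable_vecI) simp

context prob_space
begin

text \<open>
  Both variables of \<open>indep_var\<close> must have the same type; the coordinate \<open>j\<close> is therefore represented
  by the vector that is \<open>0\<close> elsewhere.
\<close>

lemma indep_var_vec_upd:
  fixes P :: "'a \<Rightarrow> real ^ 'n"
  assumes "indep_vars (\<lambda>_. borel) (\<lambda>j \<omega>. P \<omega> $ j) UNIV"
  shows "indep_var borel (\<lambda>\<omega>. vec_upd 0 j (P \<omega> $ j)) borel (\<lambda>\<omega>. vec_upd (P \<omega>) j 0)"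
proof -
  let ?f = "\<lambda>f :: 'n \<Rightarrow> real. vec_upd 0 j (f j)" and ?g = "\<lambda>f :: 'n \<Rightarrow> real. vec_upd (\<chi> k. f k) j 0"
  have "?g \<in> borel_measurable (PiM (- {j}) (\<lambda>_. borel))"
  proof (rule borel_measurable_vecI)
    fix k show "(\<lambda>f. ?g f $ k) \<in> borel_measurable (PiM (- {j}) (\<lambda>_. borel))"
      by (cases "k = j") auto
  qed
  moreover have "?f \<in> borel_measurable (PiM {j} (\<lambda>_. borel))"
    by measurable
  ultimately have "indep_var borel (?f \<circ> (\<lambda>\<omega>. \<lambda>i\<in>{j}. P \<omega> $ i)) borel (?g \<circ> (\<lambda>\<omega>. \<lambda>i\<in>- {j}. P \<omega> $ i))"
    by (intro indep_var_compose[OF indep_var_restrict[OF assms]]) auto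
  moreover have "?g \<circ> (\<lambda>\<omega>. \<lambda>i\<in>- {j}. P \<omega> $ i) = (\<lambda>\<omega>. vec_upd (P \<omega>) j 0)"
    by (auto simp: vec_eq_iff fun_eq_iff)
  moreover have "?f \<circ> (\<lambda>\<omega>. \<lambda>i\<in>{j}. P \<omega> $ i) = (\<lambda>\<omega>. vec_upd 0 j (P \<omega> $ j))"
    by auto
  ultimately show ?thesis by simp
qed

text \<open>Replacing the \<open>j\<close>-th coordinate by an independent copy leaves the law
  unchanged. The first form fixes the other coordinates in the outer integral, for leave-one-out
  arguments; the second fixes the \<open>j\<close>-th one.\<close>

lemma nn_integral_vec_upd:
  fixes P :: "'a \<Rightarrow> real ^ 'n"
  assumes indep: "indep_vars (\<lambda>_. borel) (\<lambda>j \<omega>. P \<omega> $ j) UNIV"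
    and h [measurable]: "h \<in> borel_measurable borel"
  shows "(\<integral>\<^sup>+\<omega>. h (P \<omega>) \<partial>M) = (\<integral>\<^sup>+\<omega>'. \<integral>\<^sup>+\<omega>. h (vec_upd (P \<omega>') j (P \<omega> $ j)) \<partial>M \<partial>M)"
    and "(\<integral>\<^sup>+\<omega>. h (P \<omega>) \<partial>M) = (\<integral>\<^sup>+\<omega>. \<integral>\<^sup>+\<omega>'. h (vec_upd (P \<omega>') j (P \<omega> $ j)) \<partial>M \<partial>M)"
proof -
  let ?h = "\<lambda>(x :: real ^ 'n, y). h (vec_upd y j (x $ j))"
  have *: "?h \<in> borel_measurable (borel \<Otimes>\<^sub>M borel)" by measurable
  have upd: "vec_upd (vec_upd p j 0) j x = vec_upd p j x" "vec_upd p j (p $ j) = p" for p :: "real ^ 'n" and x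
    by (auto simp: vec_eq_iff)
  show "(\<integral>\<^sup>+\<omega>. h (P \<omega>) \<partial>M) = (\<integral>\<^sup>+\<omega>'. \<integral>\<^sup>+\<omega>. h (vec_upd (P \<omega>') j (P \<omega> $ j)) \<partial>M \<partial>M)"
    using nn_integral_indep_pair(2)[OF indep_var_vec_upd[OF indep] *, of j] by (simp add: upd)
  show "(\<integral>\<^sup>+\<omega>. h (P \<omega>) \<partial>M) = (\<integral>\<^sup>+\<omega>. \<integral>\<^sup>+\<omega>'. h (vec_upd (P \<omega>') j (P \<omega> $ j)) \<partial>M \<partial>M)"
    using nn_integral_indep_pair(1)[OF indep_var_vec_upd[OF indep] *, of j] by (simp add: upd)
qed

text \<open>
  The property \<open>Pr (P \<in> D | P\<^sub>j \<le> u) \<le> Pr (P \<in> D | P\<^sub>j \<le> v)\<close>, cleared of denominators. It is weaker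
  than PRDS, and the independent case has it as well.
\<close>

definition lower_tail_dependent :: "('a \<Rightarrow> real ^ 'n) \<Rightarrow> 'n \<Rightarrow> bool" where
  "lower_tail_dependent P j \<longleftrightarrow> (\<forall>D\<in>sets borel. increasing_set D \<longrightarrow> (\<forall>u v. u \<le> v \<longrightarrow>
     prob {\<omega> \<in> space M. P \<omega> \<in> D \<and> P \<omega> $ j \<le> u} * prob {\<omega> \<in> space M. P \<omega> $ j \<le> v} \<le>
     prob {\<omega> \<in> space M. P \<omega> \<in> D \<and> P \<omega> $ j \<le> v} * prob {\<omega> \<in> space M. P \<omega> $ j \<le> u}))"

text \<open>Up to denominators this compares conditional means of \<open>g (X \<omega>)\<close>:
  passing from \<open>X \<omega> \<le> u\<close> to \<open>X \<omega> \<le> v\<close> adds only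
  points where \<open>g\<close> is at least \<open>g u\<close>, whereas it is at most
  \<open>g u\<close> on the smaller event.\<close>

lemma lower_tail_mono:
  fixes X :: "'a \<Rightarrow> real"
  assumes [measurable]: "X \<in> borel_measurable M" and g: "mono g" "integrable M (\<lambda>\<omega>. g (X \<omega>))"
    and F: "\<And>u. F u = (\<integral>\<omega>. indicator {\<omega> \<in> space M. X \<omega> \<le> u} \<omega> * g (X \<omega>) \<partial>M)"
    and uv: "u \<le> v"
  shows "F u * prob {\<omega> \<in> space M. X \<omega> \<le> v} \<le> F v * prob {\<omega> \<in> space M. X \<omega> \<le> u}"
proof -
  let ?A = "{\<omega> \<in> space M. X \<omega> \<le> u}" and ?B = "{\<omega> \<in> space M. u < X \<omega> \<and> X \<omega> \<le> v}"
    and ?C = "{\<omega> \<in> space M. X \<omega> \<le> v}"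
  let ?b = "\<integral>\<omega>. indicator ?B \<omega> * g (X \<omega>) \<partial>M"
  have int: "integrable M (\<lambda>\<omega>. indicator A \<omega> * g (X \<omega>))" "integrable M (\<lambda>\<omega>. indicator A \<omega> * g u)"
    if "A \<in> sets M" for A
    using that integrable_mult_indicator[OF that g(2)] by (auto simp: less_top[symmetric])
  have ind: "indicator ?C \<omega> = (indicator ?A \<omega> + indicator ?B \<omega> :: real)" for \<omega>
    using uv by (auto simp: indicator_def)
  have C: "prob ?C = prob ?A + prob ?B"
  proof -
    have "?C = ?A \<union> ?B" using uv by auto
    then show ?thesis by (simp only:) (rule finite_measure_Union; auto)
  qed
  have Fv: "F v = F u + ?b"
    unfolding F ind by (simp add: distrib_right int)
  have "F u \<le> (\<integral>\<omega>. indicator ?A \<omega> * g u \<partial>M)"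
    unfolding F by (intro integral_mono int) (auto simp: indicator_def intro: monoD[OF g(1)])
  then have 1: "F u \<le> prob ?A * g u" by simp
  have "(\<integral>\<omega>. indicator ?B \<omega> * g u \<partial>M) \<le> ?b"
    by (intro integral_mono int) (auto simp: indicator_def intro!: monoD[OF g(1)])
  then have 2: "prob ?B * g u \<le> ?b" by simp
  have "F u * prob ?B \<le> prob ?A * g u * prob ?B" by (intro mult_right_mono 1) simp
  also have "\<dots> \<le> ?b * prob ?A" using mult_right_mono[OF 2, of "prob ?A"] by (simp add: mult_ac)
  finally show ?thesis unfolding C Fv by (simp add: algebra_simps)
qed

text \<open>The events \<open>P \<omega> $ j \<le> w\<close> belong to the sigma-algebra generated
  by the \<open>j\<close>-th coordinate, so on them the conditional probability integrates to the
  joint one and may be replaced by its nondecreasing version \<open>g\<close>.\<close>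

lemma PRDS_imp_lower_tail_dependent:
  fixes P :: "'a \<Rightarrow> real ^ 'n::finite"
  assumes [measurable]: "P \<in> borel_measurable M" and "PRDS M P J" "j \<in> J"
  shows "lower_tail_dependent P j"
  unfolding lower_tail_dependent_def
proof (intro ballI impI allI)
  fix D :: "(real ^ 'n) set" and u v :: real
  assume D [measurable]: "D \<in> sets borel" and inc: "increasing_set D" and "u \<le> v"
  let ?X = "\<lambda>\<omega>. P \<omega> $ j" and ?E = "{\<omega> \<in> space M. P \<omega> \<in> D}"
  let ?G = "vimage_algebra (space M) ?X borel"
  let ?f = "real_cond_exp M ?G (indicator ?E)"
  obtain g where g: "mono g" "AE \<omega> in M. ?f \<omega> = g (?X \<omega>)"
    using assms(2,3) D inc unfolding PRDS_def by blast
  have [measurable]: "g \<in> borel_measurable borel" using g(1) by (rule borel_measurable_mono)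
  have "subalgebra M ?G"
    unfolding subalgebra_def by (auto simp: sets_vimage_algebra2 intro!: measurable_sets)
  then interpret G: sigma_finite_subalgebra M ?G
    by (intro finite_measure_subalgebra_is_sigma_finite finite_measure_subalgebra.intro
        finite_measure_subalgebra_axioms.intro finite_measure_axioms)
  have E: "integrable M (indicator ?E :: 'a \<Rightarrow> real)" by (simp add: less_top[symmetric])
  have intf: "integrable M ?f" by (rule G.real_cond_exp_int(1)[OF E])
  have intg: "integrable M (\<lambda>\<omega>. g (?X \<omega>))"
    using intf by (rule Bochner_Integration.integrable_cong_AE_imp) (use g(2) in auto)
  have F: "prob {\<omega> \<in> space M. P \<omega> \<in> D \<and> ?X \<omega> \<le> w} =
      (\<integral>\<omega>. indicator {\<omega> \<in> space M. ?X \<omega> \<le> w} \<omega> * g (?X \<omega>) \<partial>M)" for w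
  proof -
    let ?A = "{\<omega> \<in> space M. ?X \<omega> \<le> w}"
    have "?A = ?X -` {..w} \<inter> space M" by auto
    then have A: "?A \<in> sets ?G" by (simp add: in_vimage_algebra)
    have "prob {\<omega> \<in> space M. P \<omega> \<in> D \<and> ?X \<omega> \<le> w} = (\<integral>\<omega>. indicator {\<omega> \<in> space M. P \<omega> \<in> D \<and> ?X \<omega> \<le> w} \<omega> \<partial>M)"
      by simp
    also have "\<dots> = (\<integral>\<omega>\<in>?A. indicator ?E \<omega> \<partial>M)"
      unfolding set_lebesgue_integral_def
      by (intro Bochner_Integration.integral_cong) (auto simp: indicator_def)
    also have "\<dots> = (\<integral>\<omega>\<in>?A. ?f \<omega> \<partial>M)" by (rule G.real_cond_exp_intA[OF E A])
    also have "\<dots> = (\<integral>\<omega>. indicator ?A \<omega> * g (?X \<omega>) \<partial>M)"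
      unfolding set_lebesgue_integral_def
      by (intro integral_cong_AE) (use g(2) in auto)
    finally show ?thesis .
  qed
  show "prob {\<omega> \<in> space M. P \<omega> \<in> D \<and> P \<omega> $ j \<le> u} * prob {\<omega> \<in> space M. P \<omega> $ j \<le> v} \<le>
     prob {\<omega> \<in> space M. P \<omega> \<in> D \<and> P \<omega> $ j \<le> v} * prob {\<omega> \<in> space M. P \<omega> $ j \<le> u}"
    by (rule lower_tail_mono[OF _ g(1) intg F \<open>u \<le> v\<close>]) simp
qed

text \<open>Under independence the conditional probability is explicit: insert the value
  \<open>x\<close> into coordinate \<open>j\<close> and average over the others. It is nondecreasing
  in \<open>x\<close> because \<open>D\<close> is increasing.\<close>

lemma indep_vars_imp_lower_tail_dependent:
  fixes P :: "'a \<Rightarrow> real ^ 'n::finite"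
  assumes [measurable]: "P \<in> borel_measurable M"
    and indep: "indep_vars (\<lambda>_. borel) (\<lambda>j \<omega>. P \<omega> $ j) UNIV"
  shows "lower_tail_dependent P j"
  unfolding lower_tail_dependent_def
proof (intro ballI impI allI)
  fix D :: "(real ^ 'n) set" and u v :: real
  assume D [measurable]: "D \<in> sets borel" and inc: "increasing_set D" and "u \<le> v"
  let ?X = "\<lambda>\<omega>. P \<omega> $ j"
  define g where "g x = prob {\<omega> \<in> space M. vec_upd (P \<omega>) j x \<in> D}" for x
  have g: "mono g"
  proof
    fix x y :: real assume "x \<le> y"
    then have "vec_upd (P \<omega>) j x \<le> vec_upd (P \<omega>) j y" for \<omega>
      by (auto simp: less_eq_vec_def)
    then have "{\<omega> \<in> space M. vec_upd (P \<omega>) j x \<in> D} \<subseteq> {\<omega> \<in> space M. vec_upd (P \<omega>) j y \<in> D}"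
      using inc unfolding increasing_set_def by blast
    then show "g x \<le> g y" unfolding g_def by (intro finite_measure_mono) auto
  qed
  have [measurable]: "g \<in> borel_measurable borel" using g by (rule borel_measurable_mono)
  have g01: "0 \<le> g x" "g x \<le> 1" for x by (auto simp: g_def)
  have intg: "integrable M (\<lambda>\<omega>. g (?X \<omega>))"
    by (rule integrable_const_bound[of _ 1]) (auto simp: g01)
  have F: "prob {\<omega> \<in> space M. P \<omega> \<in> D \<and> ?X \<omega> \<le> w} =
      (\<integral>\<omega>. indicator {\<omega> \<in> space M. ?X \<omega> \<le> w} \<omega> * g (?X \<omega>) \<partial>M)" for w
  proof -
    let ?h = "indicator {p. p \<in> D \<and> p $ j \<le> w} :: real ^ 'n \<Rightarrow> ennreal"
    have "ennreal (prob {\<omega> \<in> space M. P \<omega> \<in> D \<and> ?X \<omega> \<le> w}) = (\<integral>\<^sup>+\<omega>. ?h (P \<omega>) \<partial>M)"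
      unfolding emeasure_eq_measure[symmetric]
      by (subst nn_integral_indicator[symmetric], measurable, rule nn_integral_cong)
        (auto simp: indicator_def)
    also have "\<dots> = (\<integral>\<^sup>+\<omega>. \<integral>\<^sup>+\<omega>'. ?h (vec_upd (P \<omega>') j (?X \<omega>)) \<partial>M \<partial>M)"
      by (rule nn_integral_vec_upd(2)[OF indep]) measurable
    also have "\<dots> = (\<integral>\<^sup>+\<omega>. ennreal (indicator {\<omega> \<in> space M. ?X \<omega> \<le> w} \<omega> * g (?X \<omega>)) \<partial>M)"
    proof (rule nn_integral_cong)
      fix \<omega> assume "\<omega> \<in> space M"
      have "(\<integral>\<^sup>+\<omega>'. ?h (vec_upd (P \<omega>') j (?X \<omega>)) \<partial>M) =
          (\<integral>\<^sup>+\<omega>'. indicator {\<omega> \<in> space M. ?X \<omega> \<le> w} \<omega> *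
             indicator {\<omega>' \<in> space M. vec_upd (P \<omega>') j (?X \<omega>) \<in> D} \<omega>' \<partial>M)"
        using \<open>\<omega> \<in> space M\<close> by (intro nn_integral_cong) (auto simp: indicator_def)
      also have "\<dots> = indicator {\<omega> \<in> space M. ?X \<omega> \<le> w} \<omega> * ennreal (g (?X \<omega>))"
        by (subst nn_integral_cmult_indicator) (auto simp: g_def emeasure_eq_measure)
      finally show "(\<integral>\<^sup>+\<omega>'. ?h (vec_upd (P \<omega>') j (?X \<omega>)) \<partial>M) =
          ennreal (indicator {\<omega> \<in> space M. ?X \<omega> \<le> w} \<omega> * g (?X \<omega>))"
        by (auto simp: indicator_def)
    qed
    also have "\<dots> = ennreal (\<integral>\<omega>. indicator {\<omega> \<in> space M. ?X \<omega> \<le> w} \<omega> * g (?X \<omega>) \<partial>M)"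
      using integrable_mult_indicator[OF _ intg, of "{\<omega> \<in> space M. ?X \<omega> \<le> w}"] g01
      by (intro nn_integral_eq_integral) auto
    finally show ?thesis
      using g01 by (subst (asm) ennreal_inj) (auto intro!: integral_nonneg_AE)
  qed
  show "prob {\<omega> \<in> space M. P \<omega> \<in> D \<and> P \<omega> $ j \<le> u} * prob {\<omega> \<in> space M. P \<omega> $ j \<le> v} \<le>
     prob {\<omega> \<in> space M. P \<omega> \<in> D \<and> P \<omega> $ j \<le> v} * prob {\<omega> \<in> space M. P \<omega> $ j \<le> u}"
    by (rule lower_tail_mono[OF _ g intg F \<open>u \<le> v\<close>]) simp
qed

end

section \<open>Expected shares of a null hypothesis\<close>

text \<open>Thresholds such as \<open>real r * b\<close> may exceed \<open>1\<close>, where the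
  bound is trivial.\<close>

lemma valid_null_pvalue_le:
  assumes "prob_space M" "valid_null_pvalue M X" "0 \<le> u"
  shows "measure M {\<omega> \<in> space M. X \<omega> \<le> u} \<le> u"
proof (cases "u \<le> 1")
  case True
  then show ?thesis using assms by (auto simp: valid_null_pvalue_def)
next
  case False
  interpret prob_space M by fact
  have "prob {\<omega> \<in> space M. X \<omega> \<le> u} \<le> 1" by (rule prob_le_1)
  then show ?thesis using False by linarith
qed

context prob_space
begin

text \<open>
  With \<open>\<pi>\<^sub>r = Pr (P\<^sub>j \<le> r b) \<le> r b\<close>, the event \<open>{R = r, P\<^sub>j \<le> r b}\<close> contributes at most
  \<open>b (Pr (R \<le> r | P\<^sub>j \<le> r b) - Pr (R \<le> r - 1 | P\<^sub>j \<le> r b))\<close>. The sets \<open>{R \<le> r}\<close> are increasing, so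
  the condition in the subtracted term may be replaced by \<open>P\<^sub>j \<le> (r - 1) b\<close>, and the sum telescopes.
  If \<open>\<pi>\<^sub>r = 0\<close>, the quotients are \<open>0\<close> by the convention for division.
\<close>

lemma nn_integral_inverse_count_le:
  fixes P :: "'a \<Rightarrow> real ^ 'n::finite" and R :: "real ^ 'n \<Rightarrow> nat"
  assumes P [measurable]: "P \<in> borel_measurable M"
    and valid: "valid_null_pvalue M (\<lambda>\<omega>. P \<omega> $ j)"
    and dep: "lower_tail_dependent P j"
    and R [measurable]: "R \<in> measurable borel (count_space UNIV)"
    and anti: "\<And>p p'. p \<le> p' \<Longrightarrow> R p' \<le> R p"
    and bounded: "\<And>p. R p \<le> n" and b: "0 \<le> b"
  shows "(\<integral>\<^sup>+\<omega>. indicator {\<omega>. P \<omega> $ j \<le> real (R (P \<omega>)) * b} \<omega> / real (R (P \<omega>)) \<partial>M) \<le> ennreal b"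
proof -
  define A where "A r = {\<omega> \<in> space M. R (P \<omega>) = r \<and> P \<omega> $ j \<le> real r * b}" for r
  define Q where "Q r s = prob {\<omega> \<in> space M. P \<omega> \<in> {p. R p \<le> s} \<and> P \<omega> $ j \<le> real r * b}" for r s
  define \<pi> where "\<pi> r = prob {\<omega> \<in> space M. P \<omega> $ j \<le> real r * b}" for r
  have [measurable]: "A r \<in> sets M" for r unfolding A_def by measurable
  have \<pi>: "0 \<le> \<pi> r" "\<pi> r \<le> real r * b" for r
    using valid_null_pvalue_le[OF prob_space_axioms valid, of "real r * b"] b
    by (auto simp: \<pi>_def)
  have Q: "0 \<le> Q r s" "Q r s \<le> \<pi> r" for r s
    unfolding Q_def \<pi>_def by (auto intro!: finite_measure_mono)
  have Q_mono: "Q r s / \<pi> r \<le> Q (Suc r) s / \<pi> (Suc r)" for r s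
  proof (cases "\<pi> r = 0")
    case True
    then show ?thesis using \<pi>(1) Q(1) by simp
  next
    case False
    have "\<pi> r \<le> \<pi> (Suc r)"
      unfolding \<pi>_def using b by (intro finite_measure_mono) (auto simp: algebra_simps)
    then have pos: "0 < \<pi> r" "0 < \<pi> (Suc r)" using False \<pi>(1)[of r] by auto
    have "increasing_set {p. R p \<le> s}"
      using anti unfolding increasing_set_def by (auto intro: order_trans)
    moreover have "{p. R p \<le> s} \<in> sets borel" by measurable
    moreover have "real r * b \<le> real (Suc r) * b" using b by (simp add: algebra_simps)
    ultimately have "Q r s * \<pi> (Suc r) \<le> Q (Suc r) s * \<pi> r"
      using dep unfolding lower_tail_dependent_def Q_def \<pi>_def by blast
    then show ?thesis using pos by (simp add: field_simps)
  qed
  have A: "prob (A (Suc r)) / real (Suc r) \<le>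
      b * (Q (Suc r) (Suc r) / \<pi> (Suc r) - Q r r / \<pi> r)" for r
  proof -
    define B where "B s = {\<omega> \<in> space M. P \<omega> \<in> {p. R p \<le> s} \<and> P \<omega> $ j \<le> real (Suc r) * b}" for s
    have B: "B s \<in> sets M" for s unfolding B_def mem_Collect_eq by measurable
    have "B r \<subseteq> B (Suc r)" "A (Suc r) = B (Suc r) - B r"
      unfolding A_def B_def by auto
    then have "prob (A (Suc r)) = prob (B (Suc r)) - prob (B r)"
      using finite_measure_Diff[OF B B] by simp
    also have "\<dots> = Q (Suc r) (Suc r) - Q (Suc r) r"
      unfolding Q_def B_def ..
    also have "\<dots> = \<pi> (Suc r) * (Q (Suc r) (Suc r) / \<pi> (Suc r) - Q (Suc r) r / \<pi> (Suc r))"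
    proof (cases "\<pi> (Suc r) = 0")
      case True
      then have "Q (Suc r) s = 0" for s using Q[of "Suc r" s] by simp
      then show ?thesis using True by simp
    qed (simp add: right_diff_distrib)
    also have "\<dots> \<le> real (Suc r) * b * (Q (Suc r) (Suc r) / \<pi> (Suc r) - Q (Suc r) r / \<pi> (Suc r))"
    proof (rule mult_right_mono[OF \<pi>(2)])
      have "Q (Suc r) r \<le> Q (Suc r) (Suc r)"
        unfolding Q_def by (intro finite_measure_mono) auto
      then show "0 \<le> Q (Suc r) (Suc r) / \<pi> (Suc r) - Q (Suc r) r / \<pi> (Suc r)"
        using \<pi>(1) by (simp add: divide_right_mono)
    qed
    finally have "prob (A (Suc r)) / real (Suc r)
        \<le> b * (Q (Suc r) (Suc r) / \<pi> (Suc r) - Q (Suc r) r / \<pi> (Suc r))"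
      by (simp add: field_simps del: of_nat_Suc)
    also have "\<dots> \<le> b * (Q (Suc r) (Suc r) / \<pi> (Suc r) - Q r r / \<pi> r)"
      using Q_mono[of r r] b by (intro mult_left_mono) auto
    finally show ?thesis .
  qed
  \<comment> \<open>Decomposition by the value of the count. The value \<open>0\<close> contributes
    nothing, because division by zero gives \<open>0\<close>, so the layers start at
    \<open>Suc 0\<close>.\<close>
  have "indicator {\<omega>. P \<omega> $ j \<le> real (R (P \<omega>)) * b} \<omega> / real (R (P \<omega>)) =
      (\<Sum>r<n. indicator (A (Suc r)) \<omega> / real (Suc r))" if "\<omega> \<in> space M" for \<omega>
  proof (cases "R (P \<omega>)")
    case 0
    then show ?thesis by (auto simp: A_def)
  next
    case (Suc r)
    then have "r < n" using bounded[of "P \<omega>"] by simp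
    have "(\<Sum>r<n. indicator (A (Suc r)) \<omega> / real (Suc r)) = (\<Sum>r'\<in>{r}. indicator (A (Suc r')) \<omega> / real (Suc r'))"
      using \<open>r < n\<close> Suc by (intro sum.mono_neutral_right) (auto simp: A_def)
    then show ?thesis using Suc that by (auto simp: A_def indicator_def)
  qed
  then have "(\<integral>\<^sup>+\<omega>. indicator {\<omega>. P \<omega> $ j \<le> real (R (P \<omega>)) * b} \<omega> / real (R (P \<omega>)) \<partial>M)
      = (\<integral>\<^sup>+\<omega>. ennreal (\<Sum>r<n. indicator (A (Suc r)) \<omega> / real (Suc r)) \<partial>M)"
    by (intro nn_integral_cong) simp
  also have "\<dots> = ennreal (\<integral>\<omega>. (\<Sum>r<n. indicator (A (Suc r)) \<omega> / real (Suc r)) \<partial>M)"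
    by (intro nn_integral_eq_integral) (auto intro!: sum_nonneg integrable_real_indicator simp: less_top[symmetric])
  also have "(\<integral>\<omega>. (\<Sum>r<n. indicator (A (Suc r)) \<omega> / real (Suc r)) \<partial>M) = (\<Sum>r<n. prob (A (Suc r)) / real (Suc r))"
    by (subst Bochner_Integration.integral_sum) (auto simp: less_top[symmetric] simp del: of_nat_Suc)
  also have "\<dots> \<le> (\<Sum>r<n. b * (Q (Suc r) (Suc r) / \<pi> (Suc r) - Q r r / \<pi> r))"
    by (intro sum_mono A)
  also have "\<dots> = b * (Q n n / \<pi> n - Q 0 0 / \<pi> 0)"
    unfolding sum_distrib_left[symmetric] by (simp add: sum_lessThan_telescope[where f = "\<lambda>r. Q r r / \<pi> r"])
  also have "\<dots> \<le> b * 1"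
  proof (intro mult_left_mono b)
    have "Q n n / \<pi> n \<le> 1" using Q[of n n] \<pi>(1)[of n] by (cases "\<pi> n = 0") simp_all
    moreover have "0 \<le> Q 0 0 / \<pi> 0" using Q(1) \<pi>(1) by simp
    ultimately show "Q n n / \<pi> n - Q 0 0 / \<pi> 0 \<le> 1" by linarith
  qed
  finally show ?thesis by (simp add: ennreal_leI)
qed

text \<open>With \<open>p1\<close> fixed, the count of replicated features decreases in the
  follow-up vector, and a replicated \<open>j\<close> has a p-value of at most the count times
  \<open>b\<close>; so the bound for inverse counts applies.\<close>

lemma nn_integral_share_followup_le:
  fixes P2 :: "'a \<Rightarrow> real ^ 'n::finite"
  assumes [measurable]: "P2 \<in> borel_measurable M"
    and valid: "valid_null_pvalue M (\<lambda>\<omega>. P2 \<omega> $ j)"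
    and dep: "lower_tail_dependent P2 j" and ab: "0 \<le> a" "0 \<le> b"
  shows "(\<integral>\<^sup>+\<omega>. share j (rep_set a b S p1 (P2 \<omega>)) \<partial>M) \<le> ennreal b"
proof -
  define R where "R p = card (rep_set a b S p1 p)" for p
  have "(\<integral>\<^sup>+\<omega>. share j (rep_set a b S p1 (P2 \<omega>)) \<partial>M) \<le>
      (\<integral>\<^sup>+\<omega>. indicator {\<omega>. P2 \<omega> $ j \<le> real (R (P2 \<omega>)) * b} \<omega> / real (R (P2 \<omega>)) \<partial>M)"
  proof (intro nn_integral_mono ennreal_leI)
    fix \<omega>
    let ?D = "rep_set a b S p1 (P2 \<omega>)"
    show "share j ?D \<le> indicator {\<omega>. P2 \<omega> $ j \<le> real (R (P2 \<omega>)) * b} \<omega> / real (R (P2 \<omega>))"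
    proof (cases "j \<in> ?D")
      case True
      then show ?thesis using rep_set_le(2)[OF ab True] by (simp add: share_def R_def)
    qed (simp add: share_notin)
  qed
  also have "\<dots> \<le> ennreal b"
  proof (rule nn_integral_inverse_count_le[OF assms(1) valid dep _ _ _ ab(2)])
    have "(\<lambda>p. rep_set a b S p1 p) \<in> measurable borel (count_space UNIV)"
      by (rule measurable_rep_set[where b = "\<lambda>_. b" and S = "\<lambda>_. S" and ?P1.0 = "\<lambda>_. p1"]) auto
    then show "R \<in> measurable borel (count_space UNIV)"
      unfolding R_def by (rule measurable_compose) simp
    show "R p' \<le> R p" if "p \<le> p'" for p p'
      unfolding R_def using that by (intro card_mono rep_set_antimono) auto
    show "R p \<le> card S" for p
      unfolding R_def by (intro card_mono rep_set_subset) auto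
  qed
  finally show ?thesis .
qed

text \<open>With all primary p-values but the \<open>j\<close>-th frozen, stability fixes the
  selected set, and \<open>card_rep_set_eq\<close> then fixes the count \<open>r\<close> over all
  outcomes with \<open>j\<close> replicated. The share is dominated by the indicator of
  \<open>P1 \<omega> $ j \<le> real r * a\<close> divided by \<open>r\<close>, whose mean is at most
  \<open>a\<close>.\<close>

lemma nn_integral_share_primary_indep_le:
  fixes P1 :: "'a \<Rightarrow> real ^ 'n::finite"
  assumes [measurable]: "P1 \<in> borel_measurable M"
    and range: "\<And>\<omega>. \<omega> \<in> space M \<Longrightarrow> P1 \<omega> \<in> pval_vectors"
    and valid: "valid_null_pvalue M (\<lambda>\<omega>. P1 \<omega> $ j)"
    and indep: "indep_vars (\<lambda>_. borel) (\<lambda>j \<omega>. P1 \<omega> $ j) UNIV"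
    and sel [measurable]: "sel \<in> measurable borel (count_space UNIV)"
    and stable: "stable_rule sel"
    and a: "0 \<le> a" and b: "\<And>S. 0 \<le> b S"
  shows "(\<integral>\<^sup>+\<omega>. share j (rep_set a (b (sel (P1 \<omega>))) (sel (P1 \<omega>)) (P1 \<omega>) p2) \<partial>M) \<le> ennreal a"
proof -
  define D where "D p = rep_set a (b (sel p)) (sel p) p p2" for p
  have D [measurable]: "D \<in> measurable borel (count_space UNIV)"
    unfolding D_def by (rule measurable_rep_set) auto
  have h: "(\<lambda>p. ennreal (share j (D p))) \<in> borel_measurable borel"
    by (rule measurable_compose[OF D]) simp
  have "(\<integral>\<^sup>+\<omega>. share j (D (P1 \<omega>)) \<partial>M) =
      (\<integral>\<^sup>+\<omega>'. \<integral>\<^sup>+\<omega>. share j (D (vec_upd (P1 \<omega>') j (P1 \<omega> $ j))) \<partial>M \<partial>M)"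
    by (rule nn_integral_vec_upd(1)[OF indep h])
  also have "\<dots> \<le> (\<integral>\<^sup>+\<omega>'. ennreal a \<partial>M)"
  proof (rule nn_integral_mono)
    fix \<omega>' assume \<omega>': "\<omega>' \<in> space M"
    let ?p = "\<lambda>\<omega>. vec_upd (P1 \<omega>') j (P1 \<omega> $ j)"
    have p: "?p \<omega> \<in> pval_vectors" if "\<omega> \<in> space M" for \<omega>
      using range[OF that] range[OF \<omega>'] by (auto simp: pval_vectors_def)
    show "(\<integral>\<^sup>+\<omega>. share j (D (?p \<omega>)) \<partial>M) \<le> ennreal a"
    proof (cases "\<exists>\<omega>\<in>space M. j \<in> D (?p \<omega>)")
      case False
      then have "(\<integral>\<^sup>+\<omega>. share j (D (?p \<omega>)) \<partial>M) = (\<integral>\<^sup>+\<omega>. 0 \<partial>M)"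
        by (intro nn_integral_cong) (auto simp: share_notin)
      then show ?thesis by simp
    next
      case True
      \<comment> \<open>Any outcome with \<open>j\<close> replicated serves to name the common
        count.\<close>
      then obtain \<omega>0 where \<omega>0: "\<omega>0 \<in> space M" "j \<in> D (?p \<omega>0)" by blast
      define r where "r = card (D (?p \<omega>0))"
      have r: "0 < r" using \<omega>0(2) by (auto simp: r_def card_gt_0_iff)
      have "share j (D (?p \<omega>)) \<le> indicator {\<omega> \<in> space M. P1 \<omega> $ j \<le> real r * a} \<omega> / real r"
        if "\<omega> \<in> space M" for \<omega>
      proof (cases "j \<in> D (?p \<omega>)")
        case True
        have "sel (?p \<omega>) = sel (?p \<omega>0)"
        proof -
          have "j \<in> sel (?p \<omega>)" "j \<in> sel (?p \<omega>0)"
            using True \<omega>0(2) rep_set_subset unfolding D_def by blast+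
          moreover have "\<forall>k. k \<noteq> j \<longrightarrow> ?p \<omega> $ k = ?p \<omega>0 $ k" by simp
          ultimately show ?thesis
            using stable p[OF that] p[OF \<omega>0(1)] unfolding stable_rule_def by blast
        qed
        then have "card (D (?p \<omega>)) = r"
          using card_rep_set_eq[OF a b[of "sel (?p \<omega>)"], where j = j and p = "?p \<omega>" and p' = "?p \<omega>0"
              and S = "sel (?p \<omega>)" and ?p2.0 = p2] True \<omega>0(2)
          unfolding r_def D_def by simp
        moreover have "?p \<omega> $ j \<le> real (card (D (?p \<omega>))) * a"
          using rep_set_le(1)[OF a b] True unfolding D_def by blast
        ultimately show ?thesis using True that by (simp add: share_def)
      qed (simp add: share_notin)
      then have "(\<integral>\<^sup>+\<omega>. share j (D (?p \<omega>)) \<partial>M) \<le>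
          (\<integral>\<^sup>+\<omega>. ennreal (indicator {\<omega> \<in> space M. P1 \<omega> $ j \<le> real r * a} \<omega> / real r) \<partial>M)"
        by (intro nn_integral_mono ennreal_leI)
      also have "\<dots> = ennreal (\<integral>\<omega>. indicator {\<omega> \<in> space M. P1 \<omega> $ j \<le> real r * a} \<omega> / real r \<partial>M)"
        by (intro nn_integral_eq_integral) (auto simp: less_top[symmetric])
      also have "\<dots> = ennreal (prob {\<omega> \<in> space M. P1 \<omega> $ j \<le> real r * a} / real r)"
        by simp
      also have "\<dots> \<le> ennreal a"
        using valid_null_pvalue_le[OF prob_space_axioms valid, of "real r * a"] a r
        by (intro ennreal_leI) (simp add: field_simps)
      finally show ?thesis .
    qed
  qed
  also have "\<dots> = ennreal a" by (simp add: emeasure_space_1)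
  finally show ?thesis unfolding D_def .
qed

text \<open>
  For arbitrary dependence, \<open>1 / R\<close> on the event \<open>X \<le> R a\<close> is dominated by a function of \<open>X\<close>
  alone (Benjamini and Yekutieli), whose expectation produces the harmonic number.
\<close>

definition BY_weight :: "nat \<Rightarrow> real \<Rightarrow> real \<Rightarrow> real" where
  "BY_weight K a x = (\<Sum>i = 1..<K. (1 / real i - 1 / real (Suc i)) * indicator {..real i * a} x)
     + indicator {..real K * a} x / real K"

lemma BY_weight_nonneg: "0 \<le> BY_weight K a x"
  unfolding BY_weight_def by (intro add_nonneg_nonneg sum_nonneg mult_nonneg_nonneg) (auto simp: frac_le)

text \<open>If \<open>r \<le> K\<close>, the part of the sum from \<open>r\<close> on telescopes,
  together with the last term, to \<open>1 / r\<close>, and all its indicators are \<open>1\<close>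
  since \<open>x \<le> real r * a\<close>. If \<open>r > K\<close>, the last term suffices.\<close>

lemma inverse_le_BY_weight:
  assumes a: "0 \<le> a" and r: "0 < r" and x: "x \<le> real r * a" "x \<le> real K * a" and K: "0 < K"
  shows "1 / real r \<le> BY_weight K a x"
proof (cases "r \<le> K")
  case True
  have "1 / real r = (\<Sum>i = r..<K. (1 / real i - 1 / real (Suc i))) + 1 / real K"
    using sum_Suc_diff'[OF True, of "\<lambda>i. - 1 / real i"] by simp
  also have "\<dots> \<le> (\<Sum>i = r..<K. (1 / real i - 1 / real (Suc i)) * indicator {..real i * a} x)
      + indicator {..real K * a} x / real K"
  proof (intro add_mono sum_mono)
    fix i assume "i \<in> {r..<K}"
    then have "real r * a \<le> real i * a" using a by (intro mult_right_mono) auto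
    then show "1 / real i - 1 / real (Suc i) \<le> (1 / real i - 1 / real (Suc i)) * indicator {..real i * a} x"
      using x by simp
  qed (use x in simp)
  also have "\<dots> \<le> BY_weight K a x"
    unfolding BY_weight_def using r by (intro add_mono sum_mono2) (auto simp: frac_le)
  finally show ?thesis .
next
  case False
  then have "1 / real r \<le> 1 / real K" using K by (simp add: frac_le)
  also have "\<dots> \<le> BY_weight K a x"
    unfolding BY_weight_def using x by (auto intro!: sum_nonneg mult_nonneg_nonneg simp: frac_le)
  finally show ?thesis .
qed

lemma nn_integral_BY_weight_le:
  assumes [measurable]: "X \<in> borel_measurable M"
    and valid: "valid_null_pvalue M X" and a: "0 \<le> a" and K: "0 < K"
  shows "(\<integral>\<^sup>+\<omega>. BY_weight K a (X \<omega>) \<partial>M) \<le> ennreal (a * harm K)"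
proof -
  have int: "integrable M (\<lambda>\<omega>. indicator {..c} (X \<omega>) :: real)" for c
    by (rule integrable_const_bound[of _ 1]) auto
  have le: "(\<integral>\<omega>. indicator {..c} (X \<omega>) \<partial>M) \<le> c" if "0 \<le> c" for c
  proof -
    have "(\<integral>\<omega>. indicator {..c} (X \<omega>) \<partial>M) =
        (\<integral>\<omega>. indicator {\<omega> \<in> space M. X \<omega> \<le> c} \<omega> \<partial>M :: real)"
      by (intro Bochner_Integration.integral_cong) (auto simp: indicator_def)
    then show ?thesis
      using valid_null_pvalue_le[OF prob_space_axioms valid that] by simp
  qed
  have int_sum: "integrable M (\<lambda>\<omega>. \<Sum>i = 1..<K. (1 / real i - 1 / real (Suc i)) * indicator {..real i * a} (X \<omega>))"
    and int_last: "integrable M (\<lambda>\<omega>. indicator {..real K * a} (X \<omega>) / real K)"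
    by (intro Bochner_Integration.integrable_sum integrable_mult_right integrable_divide int)+
  then have "(\<integral>\<^sup>+\<omega>. BY_weight K a (X \<omega>) \<partial>M) = ennreal (\<integral>\<omega>. BY_weight K a (X \<omega>) \<partial>M)"
    by (intro nn_integral_eq_integral AE_I2 BY_weight_nonneg)
      (simp only: BY_weight_def Bochner_Integration.integrable_add)
  also have "(\<integral>\<omega>. BY_weight K a (X \<omega>) \<partial>M) =
      (\<Sum>i = 1..<K. (1 / real i - 1 / real (Suc i)) * (\<integral>\<omega>. indicator {..real i * a} (X \<omega>) \<partial>M))
      + (\<integral>\<omega>. indicator {..real K * a} (X \<omega>) \<partial>M) / real K"
    unfolding BY_weight_def Bochner_Integration.integral_add[OF int_sum int_last]
    by (subst Bochner_Integration.integral_sum)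
      (simp_all only: integral_mult_right_zero integral_divide_zero integrable_mult_right int)
  also have "\<dots> \<le> (\<Sum>i = 1..<K. (1 / real i - 1 / real (Suc i)) * (real i * a)) + (real K * a) / real K"
    using a by (intro add_mono sum_mono mult_left_mono divide_right_mono le) (auto simp: frac_le)
  \<comment> \<open>The bound \<open>real i * a\<close> for the probability cancels a factor of
    \<open>1 / (i * (i + 1))\<close>. This leaves the harmonic terms from \<open>2\<close> to
    \<open>K\<close>; the last summand of the weight supplies the first one.\<close>
  also have "(\<Sum>i = 1..<K. (1 / real i - 1 / real (Suc i)) * (real i * a)) = (\<Sum>i = 1..<K. a * inverse (real (Suc i)))"
  proof (rule sum.cong)
    fix i assume "i \<in> {1..<K}"
    then have "1 / real i - 1 / real (Suc i) = 1 / (real i * real (Suc i))" "real i \<noteq> 0"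
      by (simp_all add: field_simps)
    then show "(1 / real i - 1 / real (Suc i)) * (real i * a) = a * inverse (real (Suc i))"
      by (simp add: inverse_eq_divide del: of_nat_Suc)
  qed simp
  also have "\<dots> + real K * a / real K = a * ((\<Sum>i = 1..<K. inverse (real (Suc i))) + 1)"
    using K by (simp add: sum_distrib_left distrib_left)
  also have "(\<Sum>i = 1..<K. inverse (real (Suc i))) + 1 = harm K"
    using K by (induction K rule: nat_induct_non_zero) (auto simp: harm_expand harm_Suc)
  finally show ?thesis by (simp add: ennreal_leI)
qed

text \<open>Domination by a function of the single p-value \<open>P1 \<omega> $ j\<close> covers any
  dependence between the coordinates and any selection. \<open>K\<close> limits the levels that
  matter: the number of features in general, or a value determined by \<open>t\<close> if selected
  p-values are at most \<open>t\<close>.\<close>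

lemma nn_integral_share_primary_le:
  fixes P1 :: "'a \<Rightarrow> real ^ 'n::finite"
  assumes [measurable]: "P1 \<in> borel_measurable M"
    and valid: "valid_null_pvalue M (\<lambda>\<omega>. P1 \<omega> $ j)"
    and a: "0 \<le> a" and b: "\<And>S. 0 \<le> b S" and K: "0 < K"
    and le: "\<And>\<omega>. \<omega> \<in> space M \<Longrightarrow> j \<in> rep_set a (b (S \<omega>)) (S \<omega>) (P1 \<omega>) p2 \<Longrightarrow> P1 \<omega> $ j \<le> real K * a"
  shows "(\<integral>\<^sup>+\<omega>. share j (rep_set a (b (S \<omega>)) (S \<omega>) (P1 \<omega>) p2) \<partial>M) \<le> ennreal (a * harm K)"
proof -
  have "(\<integral>\<^sup>+\<omega>. share j (rep_set a (b (S \<omega>)) (S \<omega>) (P1 \<omega>) p2) \<partial>M) \<le>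
      (\<integral>\<^sup>+\<omega>. BY_weight K a (P1 \<omega> $ j) \<partial>M)"
  proof (intro nn_integral_mono ennreal_leI)
    fix \<omega> assume \<omega>: "\<omega> \<in> space M"
    let ?D = "rep_set a (b (S \<omega>)) (S \<omega>) (P1 \<omega>) p2"
    show "share j ?D \<le> BY_weight K a (P1 \<omega> $ j)"
    proof (cases "j \<in> ?D")
      case True
      then have "0 < card ?D" by (auto simp: card_gt_0_iff)
      then have "1 / real (card ?D) \<le> BY_weight K a (P1 \<omega> $ j)"
        using rep_set_le(1)[OF a b True] le[OF \<omega> True] a K by (intro inverse_le_BY_weight)
      then show ?thesis using True by (simp add: share_def)
    qed (simp add: share_notin BY_weight_nonneg)
  qed
  also have "\<dots> \<le> ennreal (a * harm K)"
    by (rule nn_integral_BY_weight_le) (use valid a K in auto)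
  finally show ?thesis .
qed

end

section \<open>Combining the bounds over the three kinds of null features\<close>

text \<open>The bound \<open>c\<close> for the primary shares stays abstract, so that all three
  situations can supply it in their own way. Conditioning on \<open>P2\<close> handles
  \<open>I00\<close> and \<open>I01\<close>, conditioning on \<open>P1\<close> handles
  \<open>I10\<close>.\<close>

lemma (in prob_space) replicability_FDR_rep_set_le:
  fixes P1 P2 :: "'a \<Rightarrow> real ^ 'n::finite"
  assumes disj: "I00 \<inter> I01 = {}" "I00 \<inter> I10 = {}" "I01 \<inter> I10 = {}"
    and [measurable]: "P1 \<in> borel_measurable M" "P2 \<in> borel_measurable M"
    and indep: "indep_var borel P2 borel P1"
    and sel [measurable]: "sel \<in> measurable borel (count_space UNIV)"
    and ab: "0 \<le> a" "0 \<le> b" "0 \<le> c"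
    and valid2: "\<And>j. j \<in> I00 \<union> I10 \<Longrightarrow> valid_null_pvalue M (\<lambda>\<omega>. P2 \<omega> $ j)"
    and dep2: "\<And>j. j \<in> I00 \<union> I10 \<Longrightarrow> lower_tail_dependent P2 j"
    and primary: "\<And>j p2. j \<in> I00 \<union> I01 \<Longrightarrow>
      (\<integral>\<^sup>+\<omega>. share j (rep_set a (b / real (card (sel (P1 \<omega>)))) (sel (P1 \<omega>)) (P1 \<omega>) p2) \<partial>M) \<le> ennreal c"
  shows "replicability_FDR M I00 I01 I10
      (\<lambda>\<omega>. rep_set a (b / real (card (sel (P1 \<omega>)))) (sel (P1 \<omega>)) (P1 \<omega>) (P2 \<omega>))
    \<le> real (card I00) * (c * b) + real (card I01) * c + b"
proof -
  define D where "D = (\<lambda>(p2, p1). rep_set a (b / real (card (sel p1))) (sel p1) p1 p2)"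
  have D: "D \<in> measurable (borel \<Otimes>\<^sub>M borel) (count_space UNIV)"
    unfolding D_def case_prod_beta
    by (rule measurable_rep_set[where b = "\<lambda>S. b / real (card S)"]) measurable
  have h [measurable]: "(\<lambda>z. ennreal (share j (D z))) \<in> borel_measurable (borel \<Otimes>\<^sub>M borel)" for j
    by (rule measurable_compose[OF D]) simp
  have [measurable]: "(\<lambda>\<omega>. ennreal (share j (D (P2 \<omega>, P1 \<omega>)))) \<in> borel_measurable M" for j
    by measurable
  note fubini = nn_integral_indep_pair[OF indep h]
  have primary': "(\<integral>\<^sup>+\<omega>'. share j (D (p2, P1 \<omega>')) \<partial>M) \<le> ennreal c" if "j \<in> I00 \<union> I01" for j p2
    using primary[OF that] by (simp add: D_def)

  have I01: "(\<integral>\<^sup>+\<omega>. share j (D (P2 \<omega>, P1 \<omega>)) \<partial>M) \<le> ennreal c" if "j \<in> I01" for j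
  proof -
    have "(\<integral>\<^sup>+\<omega>. share j (D (P2 \<omega>, P1 \<omega>)) \<partial>M) = (\<integral>\<^sup>+\<omega>. \<integral>\<^sup>+\<omega>'. share j (D (P2 \<omega>, P1 \<omega>')) \<partial>M \<partial>M)"
      by (rule fubini(1))
    also have "\<dots> \<le> (\<integral>\<^sup>+\<omega>. ennreal c \<partial>M)"
      using that by (intro nn_integral_mono primary') auto
    finally show ?thesis by (simp add: emeasure_space_1)
  qed

  have I00: "(\<integral>\<^sup>+\<omega>. share j (D (P2 \<omega>, P1 \<omega>)) \<partial>M) \<le> ennreal (c * b)" if "j \<in> I00" for j
  proof -
    let ?A = "{\<omega> \<in> space M. P2 \<omega> $ j \<le> b}"
    have "(\<integral>\<^sup>+\<omega>. share j (D (P2 \<omega>, P1 \<omega>)) \<partial>M) = (\<integral>\<^sup>+\<omega>. \<integral>\<^sup>+\<omega>'. share j (D (P2 \<omega>, P1 \<omega>')) \<partial>M \<partial>M)"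
      by (rule fubini(1))
    also have "\<dots> \<le> (\<integral>\<^sup>+\<omega>. ennreal c * indicator ?A \<omega> \<partial>M)"
    proof (rule nn_integral_mono)
      fix \<omega> assume \<omega>: "\<omega> \<in> space M"
      show "(\<integral>\<^sup>+\<omega>'. share j (D (P2 \<omega>, P1 \<omega>')) \<partial>M) \<le> ennreal c * indicator ?A \<omega>"
      proof (cases "P2 \<omega> $ j \<le> b")
        case True
        then show ?thesis using primary'[of j "P2 \<omega>"] that \<omega> by simp
      next
        case False
        \<comment> \<open>At most all selected features are replicated, so membership would force
          \<open>P2 \<omega> $ j \<le> b\<close>.\<close>
        have "j \<notin> D (P2 \<omega>, P1 \<omega>')" for \<omega>'
        proof
          let ?S = "sel (P1 \<omega>')"
          let ?D = "rep_set a (b / real (card ?S)) ?S (P1 \<omega>') (P2 \<omega>)"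
          assume "j \<in> D (P2 \<omega>, P1 \<omega>')"
          then have j: "j \<in> ?D" by (simp add: D_def)
          then have "0 < card ?S" using rep_set_subset by (fastforce simp: card_gt_0_iff)
          have "P2 \<omega> $ j \<le> real (card ?D) * (b / real (card ?S))"
            using ab by (intro rep_set_le(2)[OF _ _ j]) auto
          also have "\<dots> \<le> real (card ?S) * (b / real (card ?S))"
            using ab by (intro mult_right_mono) (auto intro!: card_mono rep_set_subset)
          also have "\<dots> = b" using \<open>0 < card ?S\<close> by (simp add: card_gt_0_iff)
          finally show False using False by simp
        qed
        then show ?thesis by (simp add: share_notin)
      qed
    qed
    also have "\<dots> = ennreal (c * prob ?A)"
      using ab by (subst nn_integral_cmult_indicator) (auto simp: emeasure_eq_measure ennreal_mult)
    also have "\<dots> \<le> ennreal (c * b)"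
      using that ab by (intro ennreal_leI mult_left_mono valid_null_pvalue_le[OF prob_space_axioms valid2]) auto
    finally show ?thesis .
  qed

  have I10: "(\<Sum>j\<in>I10. \<integral>\<^sup>+\<omega>. share j (D (P2 \<omega>, P1 \<omega>)) \<partial>M) \<le> ennreal b"
  proof -
    \<comment> \<open>Each selected feature gets an equal part of \<open>b\<close>, so that for
      every outcome the parts add up to at most \<open>b\<close>, although the number of selected
      features is random.\<close>
    let ?w = "\<lambda>j \<omega>'. indicator (sel (P1 \<omega>')) j * (b / real (card (sel (P1 \<omega>'))))"
    have w [measurable]: "(\<lambda>\<omega>'. ennreal (?w j \<omega>')) \<in> borel_measurable M" for j
    proof -
      have "(\<lambda>\<omega>. sel (P1 \<omega>)) \<in> measurable M (count_space UNIV)" by measurable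
      then show ?thesis by (rule measurable_compose) simp
    qed
    have "(\<integral>\<^sup>+\<omega>. share j (D (P2 \<omega>, P1 \<omega>)) \<partial>M) \<le> (\<integral>\<^sup>+\<omega>'. ?w j \<omega>' \<partial>M)" if "j \<in> I10" for j
    proof -
      have "(\<integral>\<^sup>+\<omega>. share j (D (P2 \<omega>, P1 \<omega>)) \<partial>M) = (\<integral>\<^sup>+\<omega>'. \<integral>\<^sup>+\<omega>. share j (D (P2 \<omega>, P1 \<omega>')) \<partial>M \<partial>M)"
        by (rule fubini(2))
      also have "\<dots> \<le> (\<integral>\<^sup>+\<omega>'. ?w j \<omega>' \<partial>M)"
      proof (rule nn_integral_mono)
        fix \<omega>'
        show "(\<integral>\<^sup>+\<omega>. share j (D (P2 \<omega>, P1 \<omega>')) \<partial>M) \<le> ennreal (?w j \<omega>')"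
        proof (cases "j \<in> sel (P1 \<omega>')")
          case True
          then show ?thesis
            unfolding D_def using that ab
              nn_integral_share_followup_le[of P2 j a "b / real (card (sel (P1 \<omega>')))" "sel (P1 \<omega>')" "P1 \<omega>'"]
            by (simp add: valid2 dep2)
        next
          case False
          then have "j \<notin> D (P2 \<omega>, P1 \<omega>')" for \<omega>
            unfolding D_def using rep_set_subset by fastforce
          then show ?thesis by (simp add: share_notin)
        qed
      qed
      finally show ?thesis .
    qed
    then have "(\<Sum>j\<in>I10. \<integral>\<^sup>+\<omega>. share j (D (P2 \<omega>, P1 \<omega>)) \<partial>M) \<le> (\<Sum>j\<in>I10. \<integral>\<^sup>+\<omega>'. ?w j \<omega>' \<partial>M)"
      by (rule sum_mono)
    also have "\<dots> = (\<integral>\<^sup>+\<omega>'. (\<Sum>j\<in>I10. ennreal (?w j \<omega>')) \<partial>M)"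
      by (rule nn_integral_sum[symmetric]) (rule w)
    also have "\<dots> \<le> (\<integral>\<^sup>+\<omega>'. ennreal b \<partial>M)"
    proof (rule nn_integral_mono)
      fix \<omega>'
      have "(\<Sum>j\<in>I10. ?w j \<omega>') \<le> (\<Sum>j\<in>UNIV. ?w j \<omega>')"
        using ab by (intro sum_mono2) auto
      also have "\<dots> = real (card (sel (P1 \<omega>'))) * (b / real (card (sel (P1 \<omega>'))))"
        unfolding sum_distrib_right[symmetric] by (simp add: indicator_def)
      also have "\<dots> \<le> b" using ab by simp
      finally show "(\<Sum>j\<in>I10. ennreal (?w j \<omega>')) \<le> ennreal b"
        using ab by (subst sum_ennreal) (auto intro!: ennreal_leI)
    qed
    finally show ?thesis by (simp add: emeasure_space_1)
  qed

  have "(\<integral>\<^sup>+\<omega>. ennreal ((\<Sum>j\<in>I00. share j (D (P2 \<omega>, P1 \<omega>))) + (\<Sum>j\<in>I01. share j (D (P2 \<omega>, P1 \<omega>)))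
        + (\<Sum>j\<in>I10. share j (D (P2 \<omega>, P1 \<omega>)))) \<partial>M)
      = (\<integral>\<^sup>+\<omega>. (\<Sum>j\<in>I00. ennreal (share j (D (P2 \<omega>, P1 \<omega>)))) + (\<Sum>j\<in>I01. ennreal (share j (D (P2 \<omega>, P1 \<omega>))))
        + (\<Sum>j\<in>I10. ennreal (share j (D (P2 \<omega>, P1 \<omega>)))) \<partial>M)"
    by (intro nn_integral_cong) (simp add: sum_nonneg share_nonneg sum_ennreal)
  also have "\<dots> = (\<Sum>j\<in>I00. \<integral>\<^sup>+\<omega>. share j (D (P2 \<omega>, P1 \<omega>)) \<partial>M) + (\<Sum>j\<in>I01. \<integral>\<^sup>+\<omega>. share j (D (P2 \<omega>, P1 \<omega>)) \<partial>M)
        + (\<Sum>j\<in>I10. \<integral>\<^sup>+\<omega>. share j (D (P2 \<omega>, P1 \<omega>)) \<partial>M)"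
    by (simp add: nn_integral_add nn_integral_sum)
  also have "\<dots> \<le> (\<Sum>j\<in>I00. ennreal (c * b)) + (\<Sum>j\<in>I01. ennreal c) + ennreal b"
    by (intro add_mono sum_mono I00 I01 I10)
  also have "\<dots> = ennreal (real (card I00) * (c * b) + real (card I01) * c + b)"
    using ab by (simp add: ennreal_of_nat_eq_real_of_nat ennreal_mult)
  finally show ?thesis
    unfolding replicability_FDR_eq[OF disj] D_def using ab
    by (intro integral_real_bounded) auto
qed

lemma pval_vectors_borel [measurable]: "(pval_vectors :: (real ^ 'n::finite) set) \<in> sets borel"
  unfolding pval_vectors_def by measurable

lemma pval_vectorsD: "p \<in> pval_vectors \<Longrightarrow> 0 < p $ j"
  by (simp add: pval_vectors_def)

text \<open>The form of \<open>c1\<close> comes from here: \<open>l00 \<le> k00 / m\<close> bounds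
  \<open>k00 * (c2 * q) + k01\<close> by \<open>m\<close> times the denominator of
  \<open>c1\<close>, so the primary terms use at most \<open>q * (1 - c2)\<close> and leave
  \<open>c2 * q\<close> for the follow-up study.\<close>

lemma level_bound:
  assumes "0 < q" "q < 1" "0 < c2" "c2 < 1" "0 \<le> l00" "l00 < 1" "0 < m"
    and l00_le: "l00 \<le> k00 / m" and le: "k00 + k01 \<le> m"
  shows "k00 * (q * c1 c2 l00 q / m * (c2 * q)) + k01 * (q * c1 c2 l00 q / m) + c2 * q \<le> q"
proof -
  define d where "d = 1 - l00 * (1 - c2 * q)"
  define c where "c = q * c1 c2 l00 q / m"
  have c: "c = q * (1 - c2) / d / m" by (simp add: c_def c1_def d_def)
  have d: "0 < d" using c1_pos(1)[of c2 l00 q] assms by (simp add: d_def)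
  have "c2 * q < 1 * 1" using assms by (intro mult_strict_mono) auto
  then have cq: "c2 * q < 1" by simp
  have "k00 * (c2 * q) + k01 \<le> m - k00 * (1 - c2 * q)" using le by (simp add: algebra_simps)
  also have "\<dots> \<le> m - (l00 * m) * (1 - c2 * q)"
    using l00_le cq \<open>0 < m\<close> by (intro diff_left_mono mult_right_mono) (auto simp: field_simps)
  also have "\<dots> = m * d" by (simp add: d_def algebra_simps)
  finally have "(k00 * (c2 * q) + k01) * c \<le> m * d * c"
    unfolding c using assms d by (intro mult_right_mono) auto
  also have "\<dots> = q - c2 * q" unfolding c using d \<open>0 < m\<close> by (simp add: field_simps)
  finally show ?thesis
    unfolding c_def[symmetric] by (simp add: algebra_simps)
qed

section \<open>The false discovery rate for replicability\<close>

theorem theorem2p1: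
  fixes M :: "'a measure"
    and P1 P2 :: "'a \<Rightarrow> real ^ 'n"
    and sel :: "real ^ 'n \<Rightarrow> 'n set"
    and I00 I01 I10 I11 :: "'n set"
    and q c2 l00 :: real
  assumes "prob_space M"
    and "0 < q" "q < 1" "0 < c2" "c2 < 1" "0 \<le> l00" "l00 < 1"
    and partition: "I00 \<union> I01 \<union> I10 \<union> I11 = UNIV"
      "I00 \<inter> I01 = {}" "I00 \<inter> I10 = {}" "I00 \<inter> I11 = {}"
      "I01 \<inter> I10 = {}" "I01 \<inter> I11 = {}" "I10 \<inter> I11 = {}"
    and random_vectors: "P1 \<in> borel_measurable M" "P2 \<in> borel_measurable M"
    and range: "\<And>\<omega>. \<omega> \<in> space M \<Longrightarrow> P1 \<omega> \<in> pval_vectors"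
      "\<And>\<omega>. \<omega> \<in> space M \<Longrightarrow> P2 \<omega> \<in> pval_vectors"
    and valid1: "\<And>j. j \<in> I00 \<union> I01 \<Longrightarrow> valid_null_pvalue M (\<lambda>\<omega>. P1 \<omega> $ j)"
    and valid2: "\<And>j. j \<in> I00 \<union> I10 \<Longrightarrow> valid_null_pvalue M (\<lambda>\<omega>. P2 \<omega> $ j)"
    and sel_measurable:
      "sel \<in> measurable (restrict_space borel pval_vectors) (count_space UNIV)"
    and stable: "stable_rule sel"
    and l00_le: "l00 \<le> real (card I00) / real CARD('n)"
    and followup: "prob_space.indep_vars M (\<lambda>_. borel) (\<lambda>j \<omega>. P2 \<omega> $ j) UNIV
      \<or> PRDS M P2 (I00 \<union> I10)"
    and indep: "prob_space.indep_var M borel P2 borel P1"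
  shows
    "(prob_space.indep_vars M (\<lambda>_. borel) (\<lambda>j \<omega>. P1 \<omega> $ j) UNIV \<longrightarrow>
        replicability_FDR M I00 I01 I10
          (\<lambda>\<omega>. declared q (r_value c2 l00) sel (P1 \<omega>) (P2 \<omega>)) \<le> q)
     \<and> replicability_FDR M I00 I01 I10
          (\<lambda>\<omega>. declared q (r_value_m_star c2 l00) sel (P1 \<omega>) (P2 \<omega>)) \<le> q
     \<and> (\<forall>t. 0 < t \<and> t < 1 \<and> (\<forall>p\<in>pval_vectors. \<forall>j\<in>sel p. p $ j \<le> t) \<longrightarrow>
        replicability_FDR M I00 I01 I10
          (\<lambda>\<omega>. declared q (r_value_c1_tilde t c2 l00) sel (P1 \<omega>) (P2 \<omega>)) \<le> q)"
proof -
  interpret prob_space M by fact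
  note q = \<open>0 < q\<close> \<open>q < 1\<close> and c2 = \<open>0 < c2\<close> \<open>c2 < 1\<close> and l00 = \<open>0 \<le> l00\<close> \<open>l00 < 1\<close>
  note [measurable] = random_vectors
  define m where "m = real CARD('n)"
  have m: "0 < m" by (simp add: m_def)
  \<comment> \<open>\<open>sel\<close> is assumed measurable on \<open>pval_vectors\<close> only;
    its extension by the empty set is measurable everywhere and agrees with it along
    \<open>P1\<close>.\<close>
  define sel' where "sel' p = (if p \<in> pval_vectors then sel p else {})" for p
  have sel' [measurable]: "sel' \<in> measurable borel (count_space UNIV)"
    unfolding sel'_def by (subst measurable_restrict_space_iff[symmetric]) (use sel_measurable in auto)
  have stable': "stable_rule sel'"
    using stable unfolding stable_rule_def sel'_def by simp
  define c where "c = q * c1 c2 l00 q / m"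
  have c1q: "0 < c1 c2 l00 q" using c1_pos(2)[OF c2 l00 q(1)] .
  have dep: "lower_tail_dependent P2 j" if "j \<in> I00 \<union> I10" for j
    using followup indep_vars_imp_lower_tail_dependent[OF random_vectors(2)]
      PRDS_imp_lower_tail_dependent[OF random_vectors(2) _ that] by blast
  define Rep where "Rep a \<omega> = rep_set a (c2 * q / real (card (sel' (P1 \<omega>)))) (sel' (P1 \<omega>)) (P1 \<omega>) (P2 \<omega>)" for a \<omega>

  \<comment> \<open>Each situation reduces to identifying the declared set with \<open>Rep a\<close>
    and bounding the primary shares by the same \<open>c\<close>; only \<open>a\<close>
    varies.\<close>
  have bound: "replicability_FDR M I00 I01 I10 F \<le> q"
    if a: "0 \<le> a" and F: "\<And>\<omega>. \<omega> \<in> space M \<Longrightarrow> F \<omega> = Rep a \<omega>"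
      and primary: "\<And>j p2. j \<in> I00 \<union> I01 \<Longrightarrow>
        (\<integral>\<^sup>+\<omega>. share j (rep_set a (c2 * q / real (card (sel' (P1 \<omega>)))) (sel' (P1 \<omega>)) (P1 \<omega>) p2) \<partial>M) \<le> ennreal c"
    for a F
  proof -
    have "replicability_FDR M I00 I01 I10 F = replicability_FDR M I00 I01 I10 (Rep a)"
      unfolding replicability_FDR_def using F by (intro Bochner_Integration.integral_cong) auto
    also have "\<dots> \<le> real (card I00) * (c * (c2 * q)) + real (card I01) * c + c2 * q"
      unfolding Rep_def
      by (rule replicability_FDR_rep_set_le[OF partition(2,3,5) random_vectors indep sel' a _ _ valid2 dep primary])
        (use q c2 m c1q in \<open>auto simp: c_def\<close>)
    also have "\<dots> \<le> q"
    proof -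
      have "card I00 + card I01 = card (I00 \<union> I01)" using partition by (simp add: card_Un_disjoint)
      also have "\<dots> \<le> CARD('n)" by (intro card_mono) auto
      finally have "real (card I00) + real (card I01) \<le> m" by (simp add: m_def)
      then show ?thesis
        unfolding c_def using level_bound[OF q c2 l00 m] l00_le by (simp add: m_def)
    qed
    finally show ?thesis .
  qed

  have declared: "declared q r sel (P1 \<omega>) (P2 \<omega>) = Rep (q * k q / m') \<omega>"
    if \<omega>: "\<omega> \<in> space M" and m': "0 < m'" and k: "\<And>x. 0 < x \<Longrightarrow> 0 < k x"
      and r: "\<And>i. i \<in> sel (P1 \<omega>) \<Longrightarrow> r (sel (P1 \<omega>)) (P1 \<omega>) (P2 \<omega>) i \<le> q \<longleftrightarrow>
        f_value m' k c2 (sel (P1 \<omega>)) (P1 \<omega>) (P2 \<omega>) i q \<le> q"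
    for r k m' \<omega>
  proof -
    have sel: "sel' (P1 \<omega>) = sel (P1 \<omega>)" using range(1)[OF \<omega>] by (simp add: sel'_def)
    have "r (sel (P1 \<omega>)) (P1 \<omega>) (P2 \<omega>) i \<le> q \<longleftrightarrow> i \<in> Rep (q * k q / m') \<omega>"
      if "i \<in> sel (P1 \<omega>)" for i
      unfolding r[OF that] Rep_def sel
      by (rule f_value_le_self_iff) (use m' c2 k q that range[OF \<omega>] pval_vectorsD in auto)
    moreover have "Rep (q * k q / m') \<omega> \<subseteq> sel (P1 \<omega>)"
      unfolding Rep_def sel by (rule rep_set_subset)
    ultimately show ?thesis unfolding declared_def by blast
  qed

  have c1_cont: "continuous_on {0<..<1} (c1 c2 l00)"
    using continuous_on_c1[OF c2 l00] by (rule continuous_on_subset) auto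
  have declared_c1: "declared q (\<lambda>S p1 p2 i. r_solution (f_value m' (c1 c2 l00) c2 S p1 p2 i)) sel (P1 \<omega>) (P2 \<omega>)
      = Rep (q * c1 c2 l00 q / m') \<omega>" if "\<omega> \<in> space M" "0 < m'" for m' \<omega>
    using that c2 c1_pos(2)[OF c2 l00] range[OF that(1)] pval_vectorsD
    by (intro declared r_solution_f_value_le_iff c1_cont times_c1_strict_mono[OF c2 l00] q) auto

  \<comment> \<open>Situation 1: independent primary p-values under a stable rule\<close>
  have "replicability_FDR M I00 I01 I10 (\<lambda>\<omega>. declared q (r_value c2 l00) sel (P1 \<omega>) (P2 \<omega>)) \<le> q"
    if "indep_vars (\<lambda>_. borel) (\<lambda>j \<omega>. P1 \<omega> $ j) UNIV"
  proof (rule bound[of c])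
    show "0 \<le> c" using q m c1q by (simp add: c_def)
    show "declared q (r_value c2 l00) sel (P1 \<omega>) (P2 \<omega>) = Rep c \<omega>" if "\<omega> \<in> space M" for \<omega>
      using declared_c1[OF that m] unfolding r_value_def[abs_def] c_def m_def .
    show "(\<integral>\<^sup>+\<omega>. share j (rep_set c (c2 * q / real (card (sel' (P1 \<omega>)))) (sel' (P1 \<omega>)) (P1 \<omega>) p2) \<partial>M) \<le> ennreal c"
      if j: "j \<in> I00 \<union> I01" for j p2
      by (rule nn_integral_share_primary_indep_le[OF random_vectors(1) range(1) valid1[OF j]
            \<open>indep_vars _ _ _\<close> sel' stable' \<open>0 \<le> c\<close>, where b = "\<lambda>S. c2 * q / real (card S)"])
        (use q c2 in auto)
  qed

  \<comment> \<open>Situation 2: arbitrary dependence, compensated by \<open>m_star\<close>\<close>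
  moreover
  have "replicability_FDR M I00 I01 I10 (\<lambda>\<omega>. declared q (r_value_m_star c2 l00) sel (P1 \<omega>) (P2 \<omega>)) \<le> q"
  proof -
    define a where "a = q * c1 c2 l00 q / m_star CARD('n)"
    have harm: "0 < (harm CARD('n) :: real)" by (simp add: harm_pos)
    have m_star: "m_star CARD('n) = m * harm CARD('n)"
      by (simp add: m_star_def m_def harm_def inverse_eq_divide)
    then have m_star_pos: "0 < m_star CARD('n)" using m harm by simp
    have "(harm CARD('n) :: real) \<noteq> 0" using harm by linarith
    \<comment> \<open>The extra factor in \<open>m_star\<close> is exactly the harmonic number that
      arbitrary dependence costs when \<open>K\<close> is the number of features.\<close>
    then have ac: "a * harm CARD('n) = c" by (simp add: a_def c_def m_star)
    show ?thesis
    proof (rule bound[of a])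
      show a: "0 \<le> a" using q m_star_pos c1q by (simp add: a_def)
      show "declared q (r_value_m_star c2 l00) sel (P1 \<omega>) (P2 \<omega>) = Rep a \<omega>" if "\<omega> \<in> space M" for \<omega>
        using declared_c1[OF that m_star_pos] unfolding r_value_m_star_def[abs_def] a_def .
      show "(\<integral>\<^sup>+\<omega>. share j (rep_set a (c2 * q / real (card (sel' (P1 \<omega>)))) (sel' (P1 \<omega>)) (P1 \<omega>) p2) \<partial>M) \<le> ennreal c"
        if j: "j \<in> I00 \<union> I01" for j p2
        unfolding ac[symmetric]
      proof (rule nn_integral_share_primary_le[where b = "\<lambda>S. c2 * q / real (card S)"])
        fix \<omega>
        let ?S = "sel' (P1 \<omega>)"
        let ?D = "rep_set a (c2 * q / real (card ?S)) ?S (P1 \<omega>) p2"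
        assume "j \<in> ?D"
        then have "P1 \<omega> $ j \<le> real (card ?D) * a"
          using a q c2 by (intro rep_set_le(1)) auto
        also have "\<dots> \<le> real CARD('n) * a"
          using a by (intro mult_right_mono) (auto intro!: card_mono)
        finally show "P1 \<omega> $ j \<le> real CARD('n) * a" .
      qed (use a q c2 valid1[OF j] in auto)
    qed
  qed

  \<comment> \<open>Situation 3: arbitrary dependence with selected p-values at most
    \<open>t\<close>\<close>
  moreover
  have "replicability_FDR M I00 I01 I10 (\<lambda>\<omega>. declared q (r_value_c1_tilde t c2 l00) sel (P1 \<omega>) (P2 \<omega>)) \<le> q"
    if t: "0 < t" and le_t: "\<forall>p\<in>pval_vectors. \<forall>j\<in>sel p. p $ j \<le> t" for t
  proof -
    define a where "a = q * c1_tilde m t c2 l00 q / m"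
    \<comment> \<open>\<open>K\<close> levels of width \<open>a\<close> reach up to
      \<open>t\<close>, the bound for selected p-values, and their harmonic cost stays within
      \<open>c\<close>.\<close>
    obtain K where K: "0 < K" "t \<le> real K * a" "a * harm K \<le> c"
      using c1_tilde_harm_bound[OF m t c2 l00 q(1)] unfolding a_def c_def by metis
    show ?thesis
    proof (rule bound[of a])
      show a: "0 \<le> a" using q m c1_tilde_pos[OF m t c2 l00 q(1)] by (simp add: a_def)
      have "declared q (\<lambda>S p1 p2 i. r_minimum (f_value m (c1_tilde m t c2 l00) c2 S p1 p2 i)) sel (P1 \<omega>) (P2 \<omega>) = Rep a \<omega>"
        if "\<omega> \<in> space M" for \<omega>
        unfolding a_def using that c2 m c1_tilde_pos[OF m t c2 l00] range[OF that] pval_vectorsD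
        by (intro declared r_minimum_f_value_le_iff times_c1_tilde_strict_mono[OF m t c2 l00]
            times_c1_tilde_usc_at_right[OF m t c2 l00] q) auto
      then show "declared q (r_value_c1_tilde t c2 l00) sel (P1 \<omega>) (P2 \<omega>) = Rep a \<omega>" if "\<omega> \<in> space M" for \<omega>
        using that unfolding r_value_c1_tilde_def[abs_def] m_def by blast
      fix j p2 assume j: "j \<in> I00 \<union> I01"
      have "(\<integral>\<^sup>+\<omega>. share j (rep_set a (c2 * q / real (card (sel' (P1 \<omega>)))) (sel' (P1 \<omega>)) (P1 \<omega>) p2) \<partial>M)
          \<le> ennreal (a * harm K)"
      proof (rule nn_integral_share_primary_le[where b = "\<lambda>S. c2 * q / real (card S)"])
        fix \<omega> assume \<omega>: "\<omega> \<in> space M"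
          and "j \<in> rep_set a (c2 * q / real (card (sel' (P1 \<omega>)))) (sel' (P1 \<omega>)) (P1 \<omega>) p2"
        then have "j \<in> sel (P1 \<omega>)" using rep_set_subset range(1)[OF \<omega>] by (fastforce simp: sel'_def)
        then have "P1 \<omega> $ j \<le> t" using le_t range(1)[OF \<omega>] by blast
        then show "P1 \<omega> $ j \<le> real K * a" using K(2) by linarith
      qed (use a q c2 K valid1[OF j] in auto)
      also have "\<dots> \<le> ennreal c" using K(3) by (rule ennreal_leI)
      finally show "(\<integral>\<^sup>+\<omega>. share j (rep_set a (c2 * q / real (card (sel' (P1 \<omega>)))) (sel' (P1 \<omega>)) (P1 \<omega>) p2) \<partial>M)
          \<le> ennreal c" .
    qed
  qed
  ultimately show ?thesis by blast
qed

end
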